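(* Let $V$ be a three-dimensional Euclidean vector space over $\mathbb{R}$ with unit sphere $S(V)$, and let $x_1,x_2,\dots$ be points of $S(V)$ chosen independently and uniformly at random; for each $N$ let $X_N=\{x_1,\dots,x_N\}$. Let $C_N:\mathcal{H}_N\to\mathcal{H}_N$ be the (discrete) common lines operator of $X_N$ and let $\mathbb{V}_N=\bigoplus_{\lambda>1/3}\mathcal{H}_N(\lambda)$ be the sum of the eigenspaces of $C_N$ with eigenvalue greater than $1/3$. Then, almost surely, for all sufficiently large $N$, $$\dim \mathbb{V}_N=3.$$
   Context: For $x\in S(V)$ let $\mathrm{P}_x=x^{\perp}\subset V$ be the plane orthogonal to $x$, with the Euclidean structure induced from $V$. For $x,y\in S(V)$ let $C_{x,y}:\mathrm{P}_x\cap\mathrm{P}_y\hookrightarrow\mathrm{P}_x$ and $C_{y,x}:\mathrm{P}_x\cap\mathrm{P}_y\hookrightarrow\mathrm{P}_y$ be the inclusions, and let $C_N(x,y)=C_{x,y}\circ C_{y,x}^{t}:\mathrm{P}_y\to\mathrm{P}_x$, where $(\cdot)^t$ is the transpose with respect to the Euclidean structures. (For $x=y$ this formula gives the identity of $\mathrm{P}_x$.) Let $\mathcal{H}_N=\bigoplus_{x\in X_N}\mathrm{P}_x$, a $2N$-dimensional Euclidean space whose elements $s$ are viewed as families $s(x)\in\mathrm{P}_x$, $x\in X_N$. The common lines operator $C_N:\mathcal{H}_N\to\mathcal{H}_N$ is the symmetric operator $$C_N(s)(x)=\frac{1}{|X_N|}\sum_{y\in X_N}C_N(x,y)\big(s(y)\big).$$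 $\mathcal{H}_N(\lambda)$ denotes the eigenspace of $C_N$ for the eigenvalue $\lambda$. *)

theory Defs
  imports "HOL-Probability.Probability" "HOL-Library.Function_Algebras"
begin

text \<open>Families of vectors form a real vector space pointwise, so that the library's
  \<^const>\<open>dim\<close>, \<^const>\<open>span\<close> and \<^const>\<open>subspace\<close> apply to them.\<close>

instantiation "fun" :: (type, real_vector) real_vector
begin

definition scaleR_fun_def: "r *\<^sub>R f = (\<lambda>x. r *\<^sub>R f x)"

instance
  by standard (simp_all add: scaleR_fun_def fun_eq_iff algebra_simps)

end

text \<open>The uniform probability measure on the unit sphere is the normalised cone measure: a set
  \<open>A\<close> of unit vectors gets the fraction of the volume of the unit ball lying over \<open>A\<close>. Since
  \<^term>\<open>sgn v = v /\<^sub>R norm v\<close>, it is the law of the direction of a uniformly chosen point of the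
  ball. It is carried by the Borel sets of the whole space.\<close>

definition uniform_sphere :: "'a::euclidean_space measure"
  where "uniform_sphere = distr (uniform_measure lborel (ball 0 1)) borel sgn"

definition perp_plane :: "'a::euclidean_space \<Rightarrow> 'a set"
  where "perp_plane x = {v. x \<bullet> v = 0}"

text \<open>Transpose of a linear map \<open>f\<close> defined on a subspace \<open>U\<close>, with respect to the induced
  inner products. The library's \<^const>\<open>adjoint\<close> only covers maps between whole types.\<close>

definition transpose_on :: "'a::euclidean_space set \<Rightarrow> ('a \<Rightarrow> 'b::euclidean_space) \<Rightarrow> 'b \<Rightarrow> 'a"
  where "transpose_on U f w = (THE u. u \<in> U \<and> (\<forall>v\<in>U. f v \<bullet> w = v \<bullet> u))"

lemma transpose_on_unique:
  assumes "subspace U" "u \<in> U" "\<And>v. v \<in> U \<Longrightarrow> f v \<bullet> w = v \<bullet> u"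
  shows "transpose_on U f w = u"
  unfolding transpose_on_def
proof (rule the_equality)
  fix u' assume u': "u' \<in> U \<and> (\<forall>v\<in>U. f v \<bullet> w = v \<bullet> u')"
  then have "u' - u \<in> U"
    using assms by (simp add: subspace_diff)
  then have "(u' - u) \<bullet> (u' - u) = 0"
    using u' assms(3) by (metis inner_diff_right right_minus_eq)
  then show "u' = u"
    by simp
qed (use assms in auto)

text \<open>The inclusions \<open>C\<^bsub>x,y\<^esub>\<close> and \<open>C\<^bsub>y,x\<^esub>\<close> both act as the identity on
  \<open>P\<^sub>x \<inter> P\<^sub>y\<close>; they differ only in their codomains \<open>P\<^sub>x\<close> and \<open>P\<^sub>y\<close>. The kernel is meaningful
  for arguments in \<open>P\<^sub>y\<close> only.\<close>

definition common_line_kernel :: "'a::euclidean_space \<Rightarrow> 'a \<Rightarrow> 'a \<Rightarrow> 'a"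
  where "common_line_kernel x y = id \<circ> transpose_on (perp_plane x \<inter> perp_plane y) id"

text \<open>Elements of the direct sum over \<open>X\<close> are functions on the whole type, made unique by
  requiring them to vanish off \<open>X\<close>.\<close>

definition section_space :: "'a::euclidean_space set \<Rightarrow> ('a \<Rightarrow> 'a) set"
  where "section_space X = {s. (\<forall>x\<in>X. s x \<in> perp_plane x) \<and> (\<forall>x. x \<notin> X \<longrightarrow> s x = 0)}"

definition common_lines_operator :: "'a::euclidean_space set \<Rightarrow> ('a \<Rightarrow> 'a) \<Rightarrow> ('a \<Rightarrow> 'a)"
  where "common_lines_operator X s =
    (\<lambda>x. if x \<in> X then (1 / real (card X)) *\<^sub>R (\<Sum>y\<in>X. common_line_kernel x y (s y)) else 0)"

definition common_lines_eigenspace :: "'a::euclidean_space set \<Rightarrow> real \<Rightarrow> ('a \<Rightarrow> 'a) set"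
  where "common_lines_eigenspace X \<mu> =
    {s \<in> section_space X. common_lines_operator X s = \<mu> *\<^sub>R s}"

text \<open>Sum of the eigenspaces for eigenvalues above a threshold; non-eigenvalues contribute only
  the zero family.\<close>

definition eigenspaces_above :: "'a::euclidean_space set \<Rightarrow> real \<Rightarrow> ('a \<Rightarrow> 'a) set"
  where "eigenspaces_above X c = span (\<Union>\<mu>\<in>{c<..}. common_lines_eigenspace X \<mu>)"

end

theory Submission
  imports Defs
begin

text \<open>
  The sum \<open>\<V>\<close> of the eigenspaces above \<open>1 / 3\<close> is not merely three-dimensional: the summation
  map \<open>s \<mapsto> \<Sum>\<^sub>x s(x)\<close> sends it isomorphically onto \<open>V\<close> (\<open>dim_eigenspaces_above\<close>). This follows from two
  estimates for the quadratic form of the operator, by a variational argument that avoids a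
  full diagonalisation: the Rayleigh quotient is at most \<open>1 / 3\<close> on sections with zero sum, which
  gives injectivity, and it exceeds \<open>1 / 3\<close> on the projections \<open>x \<mapsto> a - (x \<bullet> a) x\<close> of constant fields,
  which gives surjectivity. In the limit \<open>N \<rightarrow> \<infinity>\<close> these projections are eigensections for the eigenvalue
  \<open>1 / 2\<close>.

  Both estimates hold for every finite set of unit vectors whose second and fourth moments are close to
  those of the uniform distribution (\<open>nearly_isotropic\<close>). The point is to replace the kernel, which is
  discontinuous at \<open>x = \<plusminus>y\<close>, by polynomials in inner products. For the upper bound
  (\<open>rayleigh_le_third\<close>) the kernel is compared with \<open>1 / 3\<close> times the form \<open>s(x) \<bullet> s(y)\<close>, which
  sums to zero, plus \<open>5 / 6\<close> times the form \<open>det (s(x), x, y) \<cdot> det (s(y), x, y)\<close>, which is negative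
  semidefinite on sections with zero sum. The norm of the difference is bounded pointwise by the root of a
  quadratic polynomial in \<open>(x \<bullet> y)\<^sup>2\<close> whose mean \<open>43 / 432\<close> is less than \<open>1 / 9\<close>, and the Cauchy-Schwarz
  inequality finishes the argument. For the lower bound (\<open>rayleigh_tangent_gt_third\<close>) the kernel is the
  triple product form divided by \<open>1 - (x \<bullet> y)\<^sup>2\<close>, and \<open>1 / (1 - z) \<ge> 1 + z\<close> suffices.

  Probability enters only through the moments. By rotation invariance the fourth moments of the
  uniform distribution are explicit (\<open>uniform_sphere_fourth_moment\<close>); the strong law of large numbers
  for the finitely many coordinate monomials of degree four then yields near isotropy, almost surely
  for all large \<open>N\<close>.
\<close>

section \<open>The common lines operator as a symmetric operator\<close>

definition section_inner :: "'a::euclidean_space set \<Rightarrow> ('a \<Rightarrow> 'a) \<Rightarrow> ('a \<Rightarrow> 'a) \<Rightarrow> real"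
  where "section_inner X s t = (\<Sum>x\<in>X. s x \<bullet> t x)"

lemma section_inner_linear:
  "section_inner X (s + s') t = section_inner X s t + section_inner X s' t"
  "section_inner X t (s + s') = section_inner X t s + section_inner X t s'"
  "section_inner X (r *\<^sub>R s) t = r * section_inner X s t"
  "section_inner X t (r *\<^sub>R s) = r * section_inner X t s"
  "section_inner X 0 t = 0" "section_inner X t 0 = 0"
  "section_inner X (s - s') t = section_inner X s t - section_inner X s' t"
  "section_inner X t (s - s') = section_inner X t s - section_inner X t s'"
  by (simp_all add: section_inner_def inner_left_distrib inner_right_distrib sum.distrib
      scaleR_fun_def sum_distrib_left inner_diff_left inner_diff_right sum_subtractf)

lemma section_inner_sum_left:
  "section_inner X (\<Sum>i\<in>I. f i) t = (\<Sum>i\<in>I. section_inner X (f i) t)"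
  by (rule linear_sum[of "\<lambda>s. section_inner X s t"], rule linearI) (simp_all only: section_inner_linear real_scaleR_def)

lemma section_inner_sum_right:
  "section_inner X t (\<Sum>i\<in>I. f i) = (\<Sum>i\<in>I. section_inner X t (f i))"
  by (rule linear_sum[of "section_inner X t"], rule linearI) (simp_all only: section_inner_linear real_scaleR_def)

lemma section_inner_commute: "section_inner X s t = section_inner X t s"
  by (simp add: section_inner_def inner_commute)

lemma section_inner_nonneg: "0 \<le> section_inner X s s"
  by (simp add: section_inner_def sum_nonneg)

lemma section_inner_eq_0_iff:
  assumes "finite X" "s \<in> section_space X"
  shows "section_inner X s s = 0 \<longleftrightarrow> s = 0"
proof
  assume "section_inner X s s = 0"
  then have "\<forall>x\<in>X. s x = 0"
    using assms by (simp add: section_inner_def sum_nonneg_eq_0_iff)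
  then show "s = 0"
    using assms by (auto simp: section_space_def fun_eq_iff)
qed (simp add: section_inner_linear)

lemma subspace_perp_plane: "subspace (perp_plane x)"
  by (auto simp: subspace_def perp_plane_def inner_right_distrib)

lemma transpose_on_id:
  assumes "subspace U"
  shows "transpose_on U id w \<in> U" "v \<in> U \<Longrightarrow> v \<bullet> transpose_on U id w = v \<bullet> w"
proof -
  obtain u z where u: "u \<in> span U" "\<And>v. v \<in> span U \<Longrightarrow> orthogonal z v" "w = u + z"
    using orthogonal_subspace_decomp_exists[of U w] by metis
  have U: "span U = U"
    using assms by (simp add: span_eq_iff)
  have eq: "v \<bullet> w = v \<bullet> u" if "v \<in> U" for v
    using u(2)[of v] u(3) that by (simp add: U inner_right_distrib orthogonal_def inner_commute)
  have "transpose_on U id w = u"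
    by (rule transpose_on_unique) (use assms u U eq in auto)
  then show "transpose_on U id w \<in> U" "v \<in> U \<Longrightarrow> v \<bullet> transpose_on U id w = v \<bullet> w"
    using u(1) U eq by auto
qed

lemma linear_transpose_on_id:
  assumes "subspace U"
  shows "linear (transpose_on U id)"
proof (rule linearI)
  show "transpose_on U id (v + w) = transpose_on U id v + transpose_on U id w" for v w
    by (rule transpose_on_unique)
      (use assms transpose_on_id[OF assms] in \<open>auto simp: subspace_add inner_right_distrib\<close>)
  show "transpose_on U id (r *\<^sub>R v) = r *\<^sub>R transpose_on U id v" for r v
    by (rule transpose_on_unique)
      (use assms transpose_on_id[OF assms] in \<open>auto simp: subspace_scale\<close>)
qed

lemma subspace_common_line: "subspace (perp_plane x \<inter> perp_plane y)"
  by (simp add: subspace_perp_plane subspace_inter)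

lemma linear_common_line_kernel: "linear (common_line_kernel x y)"
  by (simp add: common_line_kernel_def linear_transpose_on_id subspace_common_line)

text \<open>The kernel, a transpose of an inclusion, is the orthogonal projection onto
  \<open>P\<^sub>x \<inter> P\<^sub>y\<close>. This characterisation makes sense on all of space, so that linearity and symmetry
  hold without restriction to the planes \<open>P\<^sub>x\<close>.\<close>

lemma common_line_kernel_mem: "common_line_kernel x y w \<in> perp_plane x"
  "common_line_kernel x y w \<in> perp_plane y"
  using transpose_on_id(1)[OF subspace_common_line, of x y w] by (auto simp: common_line_kernel_def)

lemma common_line_kernel_inner:
  assumes "v \<in> perp_plane x" "v \<in> perp_plane y"
  shows "v \<bullet> common_line_kernel x y w = v \<bullet> w"
  using transpose_on_id(2)[OF subspace_common_line, of v x y w] assms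
  by (simp add: common_line_kernel_def)

lemma common_line_kernel_symmetric:
  "v \<bullet> common_line_kernel x y w = common_line_kernel y x v \<bullet> w"
proof -
  have "v \<bullet> common_line_kernel x y w = common_line_kernel x y w \<bullet> common_line_kernel y x v"
    by (simp add: common_line_kernel_inner common_line_kernel_mem inner_commute)
  also have "\<dots> = common_line_kernel y x v \<bullet> common_line_kernel x y w"
    by (simp add: inner_commute)
  also have "\<dots> = common_line_kernel y x v \<bullet> w"
    by (simp add: common_line_kernel_inner common_line_kernel_mem)
  finally show ?thesis .
qed

lemma subspace_section_space: "subspace (section_space X)"
  by (auto simp: subspace_def section_space_def perp_plane_def inner_right_distrib scaleR_fun_def)

lemma common_lines_operator_mem: "common_lines_operator X s \<in> section_space X"
  by (auto simp: section_space_def common_lines_operator_def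
      intro!: subspace_scale subspace_sum subspace_perp_plane common_line_kernel_mem)

lemma common_lines_operator_linear: "linear (common_lines_operator X)"
  by (rule linearI) (auto simp: common_lines_operator_def fun_eq_iff scaleR_fun_def
      linear_add[OF linear_common_line_kernel] linear_scale[OF linear_common_line_kernel]
      sum.distrib scaleR_add_right scaleR_sum_right mult.commute)

lemma section_inner_operator:
  "section_inner X s (common_lines_operator X t) =
    (\<Sum>x\<in>X. \<Sum>y\<in>X. s x \<bullet> common_line_kernel x y (t y)) / card X"
  by (simp add: section_inner_def common_lines_operator_def inner_sum_right sum_divide_distrib
      sum_distrib_left divide_inverse mult.commute)

lemma common_lines_operator_symmetric:
  "section_inner X s (common_lines_operator X t) = section_inner X (common_lines_operator X s) t"
proof -
  have "(\<Sum>x\<in>X. \<Sum>y\<in>X. s x \<bullet> common_line_kernel x y (t y)) =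
      (\<Sum>y\<in>X. \<Sum>x\<in>X. t y \<bullet> common_line_kernel y x (s x))"
    by (subst sum.swap, intro sum.cong refl, subst common_line_kernel_symmetric, rule inner_commute)
  then show ?thesis
    unfolding section_inner_commute[of X "common_lines_operator X s" t] by (simp only: section_inner_operator)
qed

lemma subspace_common_lines_eigenspace: "subspace (common_lines_eigenspace X \<mu>)"
proof -
  have "common_lines_operator X (s + t) = common_lines_operator X s + common_lines_operator X t"
    "common_lines_operator X (r *\<^sub>R s) = r *\<^sub>R common_lines_operator X s"
    "common_lines_operator X 0 = 0" for s t r
    by (simp_all only: linear_add[OF common_lines_operator_linear]
      linear_scale[OF common_lines_operator_linear] linear_0[OF common_lines_operator_linear])
  then show ?thesis
    using subspace_section_space[of X] unfolding subspace_def common_lines_eigenspace_def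
    by (simp add: scaleR_add_right mult.commute)
qed

section \<open>Spectral theory above a threshold\<close>

lemma common_lines_eigenspaces_orthogonal:
  assumes "s \<in> common_lines_eigenspace X \<mu>" "t \<in> common_lines_eigenspace X \<nu>" "\<mu> \<noteq> \<nu>"
  shows "section_inner X s t = 0"
proof -
  have "\<nu> * section_inner X s t = \<mu> * section_inner X s t"
    using common_lines_operator_symmetric[of X s t] assms
    by (simp add: common_lines_eigenspace_def section_inner_linear)
  then show ?thesis
    using assms(3) by simp
qed

text \<open>Grouping an element of the span by eigenvalue: one eigenvector for each of finitely many
  eigenvalues. Eigenvectors taken from the span one by one need not be orthogonal; after grouping
  they are.\<close>

lemma eigenspaces_above_decomposition:
  assumes "v \<in> eigenspaces_above X c"
  obtains L f where "finite L" "L \<subseteq> {c<..}" "\<And>\<mu>. f \<mu> \<in> common_lines_eigenspace X \<mu>"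
    "v = (\<Sum>\<mu>\<in>L. f \<mu>)"
proof -
  have "\<exists>L f. finite L \<and> L \<subseteq> {c<..} \<and> (\<forall>\<mu>. f \<mu> \<in> common_lines_eigenspace X \<mu>) \<and>
      v = (\<Sum>\<mu>\<in>L. f \<mu>)"
    using assms unfolding eigenspaces_above_def
  proof (induction rule: span_induct_alt)
    case base
    show ?case
      by (rule exI[of _ "{}"], rule exI[of _ "\<lambda>_. 0"])
        (simp only: subspace_0[OF subspace_common_lines_eigenspace] sum.empty finite.emptyI empty_subsetI simp_thms)
  next
    case (step r a y)
    from step(1) obtain \<mu> where a: "\<mu> > c" "a \<in> common_lines_eigenspace X \<mu>"
      by auto
    from step(2) obtain L f where Lf: "finite L \<and> L \<subseteq> {c<..} \<and>
        (\<forall>\<mu>. f \<mu> \<in> common_lines_eigenspace X \<mu>) \<and> y = (\<Sum>\<mu>\<in>L. f \<mu>)"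
      by (elim exE) (rule that)
    then have L: "finite L" "L \<subseteq> {c<..}" "f \<mu> \<in> common_lines_eigenspace X \<mu>"
      "y = (\<Sum>\<mu>\<in>L. f \<mu>)" for \<mu>
      by blast+
    define g where "g = (\<lambda>\<nu>. if \<nu> \<in> L then f \<nu> else 0)"
    have g: "g \<nu> \<in> common_lines_eigenspace X \<nu>" for \<nu>
      using L(3) subspace_0[OF subspace_common_lines_eigenspace] by (auto simp: g_def)
    define h where "h = g(\<mu> := r *\<^sub>R a + g \<mu>)"
    have "y = sum g (insert \<mu> L)"
      unfolding L(4) using L(1) by (intro sum.mono_neutral_cong_left) (auto simp: g_def)
    also have "sum g (insert \<mu> L) = g \<mu> + sum g (L - {\<mu>})"
      using L(1) by (rule sum.insert_remove)
    also have "sum g (L - {\<mu>}) = sum h (L - {\<mu>})"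
      by (rule sum.cong) (auto simp: h_def)
    finally have "r *\<^sub>R a + y = h \<mu> + sum h (L - {\<mu>})"
      by (simp only: h_def fun_upd_same add.assoc)
    then have "r *\<^sub>R a + y = sum h (insert \<mu> L)"
      by (simp only: sum.insert_remove[OF L(1)])
    moreover have "\<forall>\<nu>. h \<nu> \<in> common_lines_eigenspace X \<nu>"
      using g a(2) subspace_add[OF subspace_common_lines_eigenspace[of X]]
        subspace_scale[OF subspace_common_lines_eigenspace[of X]] by (simp add: h_def)
    moreover have "finite (insert \<mu> L)" "insert \<mu> L \<subseteq> {c<..}"
      using L(1,2) a(1) by auto
    ultimately have "finite (insert \<mu> L) \<and> insert \<mu> L \<subseteq> {c<..} \<and>
        (\<forall>\<nu>. h \<nu> \<in> common_lines_eigenspace X \<nu>) \<and> r *\<^sub>R a + y = sum h (insert \<mu> L)"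
      by (intro conjI)
    then show ?case
      by - (rule exI[of _ "insert \<mu> L"], rule exI[of _ h])
  qed
  then obtain L f where Lf: "finite L \<and> L \<subseteq> {c<..} \<and>
      (\<forall>\<mu>. f \<mu> \<in> common_lines_eigenspace X \<mu>) \<and> v = (\<Sum>\<mu>\<in>L. f \<mu>)"
    by (elim exE) (rule that)
  show ?thesis
    by (rule that[of L f]) (simp_all only: Lf)
qed

lemma subspace_eigenspaces_above: "subspace (eigenspaces_above X c)"
  by (simp add: eigenspaces_above_def)

lemma eigenspaces_above_subset_section_space: "eigenspaces_above X c \<subseteq> section_space X"
  unfolding eigenspaces_above_def
  by (rule span_minimal) (auto simp: common_lines_eigenspace_def subspace_section_space)

text \<open>In an orthogonal decomposition \<open>v = \<Sum> v\<^sub>\<mu>\<close> into eigenvectors, the two sides are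
  \<open>\<Sum> c \<bar>v\<^sub>\<mu>\<bar>\<^sup>2\<close> and \<open>\<Sum> \<mu> \<bar>v\<^sub>\<mu>\<bar>\<^sup>2\<close>, and every \<open>\<mu>\<close> that occurs exceeds \<open>c\<close>.\<close>

lemma rayleigh_above:
  assumes "finite X" "v \<in> eigenspaces_above X c" "v \<noteq> 0"
  shows "c * section_inner X v v < section_inner X v (common_lines_operator X v)"
proof -
  obtain L f where L: "finite L" "L \<subseteq> {c<..}"
    and f: "\<And>\<mu>. f \<mu> \<in> common_lines_eigenspace X \<mu>" and v: "v = (\<Sum>\<mu>\<in>L. f \<mu>)"
    using eigenspaces_above_decomposition[OF assms(2)] by metis
  have orth: "section_inner X (f \<mu>) (f \<nu>) = 0" if "\<mu> \<noteq> \<nu>" for \<mu> \<nu>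
    using common_lines_eigenspaces_orthogonal f that by blast
  have proj: "section_inner X v (f \<nu>) = section_inner X (f \<nu>) (f \<nu>)" if "\<nu> \<in> L" for \<nu>
  proof -
    have "section_inner X v (f \<nu>) = (\<Sum>\<mu>\<in>L. section_inner X (f \<mu>) (f \<nu>))"
      by (simp add: v section_inner_sum_left)
    also have "\<dots> = (\<Sum>\<mu>\<in>L. if \<mu> = \<nu> then section_inner X (f \<nu>) (f \<nu>) else 0)"
      by (intro sum.cong) (use orth in auto)
    also have "\<dots> = section_inner X (f \<nu>) (f \<nu>)"
      using L(1) that by simp
    finally show ?thesis .
  qed
  have "common_lines_operator X v = (\<Sum>\<mu>\<in>L. \<mu> *\<^sub>R f \<mu>)"
    using f by (simp add: v linear_sum[OF common_lines_operator_linear] common_lines_eigenspace_def)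
  then have q: "section_inner X v (common_lines_operator X v) =
      (\<Sum>\<mu>\<in>L. \<mu> * section_inner X (f \<mu>) (f \<mu>))"
    using proj by (simp add: section_inner_sum_right section_inner_linear)
  have n: "section_inner X v v = (\<Sum>\<mu>\<in>L. section_inner X (f \<mu>) (f \<mu>))"
    using proj by (subst (2) v) (simp add: section_inner_sum_right)
  obtain \<mu> where \<mu>: "\<mu> \<in> L" "f \<mu> \<noteq> 0"
    using assms(3) v by (metis sum.neutral)
  have "section_inner X (f \<nu>) (f \<nu>) > 0" if "f \<nu> \<noteq> 0" for \<nu>
    using section_inner_eq_0_iff[OF assms(1), of "f \<nu>"] section_inner_nonneg[of X "f \<nu>"] f[of \<nu>] that
    by (auto simp: common_lines_eigenspace_def less_le)
  with \<mu> have "(\<Sum>\<mu>\<in>L. c * section_inner X (f \<mu>) (f \<mu>)) <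
      (\<Sum>\<mu>\<in>L. \<mu> * section_inner X (f \<mu>) (f \<mu>))"
    using L section_inner_nonneg by (intro sum_strict_mono_ex1 bexI[of _ \<mu>])
      (auto intro!: mult_right_mono mult_strict_right_mono)
  then show ?thesis
    by (simp add: q n sum_distrib_left)
qed

lemma continuous_on_section_inner [continuous_intros]:
  assumes "\<And>x. x \<in> X \<Longrightarrow> continuous_on S (\<lambda>s. F s x)" "\<And>x. x \<in> X \<Longrightarrow> continuous_on S (\<lambda>s. G s x)"
  shows "continuous_on S (\<lambda>s. section_inner X (F s) (G s))"
  unfolding section_inner_def using assms by (intro continuous_intros) auto

lemma continuous_on_common_lines_operator:
  "continuous_on S (\<lambda>s. common_lines_operator X s x)"
proof (cases "x \<in> X")
  case True
  have "continuous_on S (\<lambda>s. common_line_kernel x y (s y))" for y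
    by (rule continuous_on_compose2[OF linear_continuous_on[of _ UNIV]
          continuous_on_product_coordinates[THEN continuous_on_subset, OF subset_UNIV]])
      (use linear_common_line_kernel in \<open>auto simp: linear_conv_bounded_linear\<close>)
  then show ?thesis
    using True by (simp add: common_lines_operator_def continuous_intros)
qed (simp add: common_lines_operator_def)

text \<open>Sections live in a function space without a norm; compactness comes from Tychonoff's theorem
  in the product topology, because a section vanishes off \<open>X\<close>.\<close>

lemma compact_section_unit_ball:
  "compact {s::'a::euclidean_space \<Rightarrow> 'a. \<forall>x. s x \<in> (if x \<in> X then cball 0 1 else {0})}"
proof -
  have "compactin (product_topology (\<lambda>_::'a. euclidean) UNIV)
      (PiE UNIV (\<lambda>x. if x \<in> X then cball (0::'a) 1 else {0}))"
    by (subst compactin_PiE) auto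
  then show ?thesis
    by (simp add: euclidean_product_topology PiE_def Pi_def)
qed

text \<open>Otherwise the quadratic form, maximised over the unit sphere of the orthogonal complement \<open>W\<close>
  of the eigenspaces above \<open>c\<close>, has a maximum \<open>m > c\<close>. As \<open>W\<close> is invariant under the operator, a
  maximiser is an eigenvector for \<open>m\<close>. It then lies both in \<open>W\<close> and in an eigenspace above \<open>c\<close>,
  which is impossible for a unit vector. Together with \<open>rayleigh_above\<close> this is all that is used of
  the spectral theorem.\<close>

lemma rayleigh_orthogonal_complement:
  fixes X :: "'a::euclidean_space set"
  assumes "finite X" "s \<in> section_space X"
    and orth: "\<And>v. v \<in> eigenspaces_above X c \<Longrightarrow> section_inner X v s = 0"
  shows "section_inner X s (common_lines_operator X s) \<le> c * section_inner X s s"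
proof (rule ccontr)
  let ?T = "common_lines_operator X" and ?B = "section_inner X"
  define W where "W = {t \<in> section_space X. \<forall>v\<in>eigenspaces_above X c. ?B v t = 0}"
  define K where "K = {t \<in> W. ?B t t = 1}"
  assume neg: "\<not> ?B s (?T s) \<le> c * ?B s s"
  have W: "subspace W"
    using subspace_section_space[of X]
    by (auto simp: W_def subspace_def section_inner_linear)
  have T0: "?T 0 = 0"
    using linear_0[OF common_lines_operator_linear] .
  have TW: "?T t \<in> W" if "t \<in> W" for t
  proof -
    have "?B v (?T t) = 0" if v: "v \<in> eigenspaces_above X c" for v
    proof -
      obtain L f where L: "finite L" "L \<subseteq> {c<..}"
        and f: "\<And>\<mu>. f \<mu> \<in> common_lines_eigenspace X \<mu>" and v: "v = (\<Sum>\<mu>\<in>L. f \<mu>)"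
        using eigenspaces_above_decomposition[OF v] by metis
      have "?B (f \<mu>) (?T t) = 0" if "\<mu> \<in> L" for \<mu>
      proof -
        have "f \<mu> \<in> eigenspaces_above X c"
          unfolding eigenspaces_above_def using L that f by (intro span_base) auto
        then have "?B (f \<mu>) t = 0"
          using \<open>t \<in> W\<close> by (simp add: W_def)
        then show ?thesis
          using f[of \<mu>]
          by (simp add: common_lines_operator_symmetric common_lines_eigenspace_def section_inner_linear)
      qed
      then show ?thesis
        by (simp add: v section_inner_sum_left)
    qed
    then show ?thesis
      by (simp add: W_def common_lines_operator_mem)
  qed
  have s: "s \<in> W" "s \<noteq> 0"
    using assms neg by (auto simp: W_def section_inner_linear T0)
  then have pos: "?B t t > 0" if "t \<in> W" "t \<noteq> 0" for t
    using section_inner_eq_0_iff[OF assms(1), of t] section_inner_nonneg[of X t] that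
    by (auto simp: W_def less_le)
  \<comment> \<open>every nonzero element of \<open>W\<close> can be scaled to the unit sphere \<open>K\<close>\<close>
  have normal: "\<exists>r. r \<noteq> 0 \<and> r *\<^sub>R t \<in> K" if "t \<in> W" "t \<noteq> 0" for t
  proof (intro exI conjI)
    show "1 / sqrt (?B t t) \<noteq> 0"
      using pos[OF that] by simp
    show "(1 / sqrt (?B t t)) *\<^sub>R t \<in> K"
      using pos[OF that] that W
      by (simp add: K_def subspace_scale section_inner_linear)
  qed
  have "closed {t. ?B t t = 1}"
    by (intro closed_Collect_eq continuous_intros continuous_on_product_coordinates)
  moreover have "closed {t. ?B v t = 0}" for v
    by (intro closed_Collect_eq continuous_intros continuous_on_product_coordinates)
  moreover have "closed {t::'a\<Rightarrow>'a. x \<bullet> t x = 0}" "closed {t::'a\<Rightarrow>'a. t x = 0}" for x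
    by (intro closed_Collect_eq continuous_intros continuous_on_product_coordinates)+
  ultimately have "closed ({t. ?B t t = 1} \<inter> (\<Inter>v\<in>eigenspaces_above X c. {t. ?B v t = 0}) \<inter>
      ((\<Inter>x\<in>X. {t. x \<bullet> t x = 0}) \<inter> (\<Inter>x\<in>-X. {t. t x = 0})))"
    by (intro closed_Int closed_INT) auto
  also have "\<dots> = K"
    by (auto simp: K_def W_def section_space_def perp_plane_def)
  finally have "closed K" .
  moreover have "K \<subseteq> {s. \<forall>x. s x \<in> (if x \<in> X then cball 0 1 else {0})}"
  proof clarify
    fix t x assume t: "t \<in> K"
    have "t x \<bullet> t x \<le> 1" if "x \<in> X"
      using member_le_sum[of x X "\<lambda>x. t x \<bullet> t x"] that assms(1) t by (simp add: K_def section_inner_def)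
    then show "t x \<in> (if x \<in> X then cball 0 1 else {0})"
      using t by (auto simp: K_def W_def section_space_def norm_le_square)
  qed
  ultimately have "compact K"
    using compact_Int_closed[OF compact_section_unit_ball[of X], of K] by (simp only: Int_absorb1)
  moreover have "K \<noteq> {}"
    using normal s by blast
  moreover have "continuous_on K (\<lambda>t. ?B t (?T t))"
    by (intro continuous_on_section_inner continuous_on_common_lines_operator
        continuous_on_product_coordinates[THEN continuous_on_subset, OF subset_UNIV])
  ultimately have "\<exists>e\<in>K. \<forall>t\<in>K. ?B t (?T t) \<le> ?B e (?T e)"
    by (rule continuous_attains_sup)
  then obtain e where e: "e \<in> K" and max: "\<And>t. t \<in> K \<Longrightarrow> ?B t (?T t) \<le> ?B e (?T e)"
    by blast
  define m where "m = ?B e (?T e)"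
  have e': "e \<in> W" "?B e e = 1"
    using e by (auto simp: K_def)
  have le: "?B t (?T t) \<le> m * ?B t t" if "t \<in> W" for t
  proof (cases "t = 0")
    case False
    then obtain r where r: "r \<noteq> 0" "r *\<^sub>R t \<in> K"
      using normal \<open>t \<in> W\<close> by blast
    have "r\<^sup>2 * ?B t (?T t) \<le> m"
      using max[OF r(2)] by (simp add: m_def linear_scale[OF common_lines_operator_linear]
          section_inner_linear power2_eq_square mult.assoc)
    also have "m = m * (r\<^sup>2 * ?B t t)"
      using r(2) by (simp add: K_def section_inner_linear power2_eq_square mult.assoc)
    finally have "r\<^sup>2 * ?B t (?T t) \<le> r\<^sup>2 * (m * ?B t t)"
      by (simp add: algebra_simps)
    then show ?thesis
      using r(1) by simp
  qed (simp add: section_inner_linear)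
  have "c < m"
  proof (rule ccontr)
    assume "\<not> c < m"
    then have "m * ?B s s \<le> c * ?B s s"
      by (intro mult_right_mono section_inner_nonneg) simp
    then show False
      using le[OF s(1)] neg by linarith
  qed
  \<comment> \<open>first order condition at the maximiser, tested against the residual \<open>h\<close> itself\<close>
  define h where "h = ?T e - m *\<^sub>R e"
  have h: "h \<in> W"
    unfolding h_def using e'(1) TW W by (simp add: subspace_diff subspace_scale)
  have Te: "?T e = h + m *\<^sub>R e"
    by (simp add: h_def)
  have eh: "?B e h = 0"
    using e' by (simp add: h_def section_inner_linear m_def)
  have "h = 0"
  proof (rule ccontr)
    assume "h \<noteq> 0"
    then have hh: "?B h h > 0"
      using pos h by blast
    define D where "D = m * ?B h h - ?B h (?T h)"
    have "D \<ge> 0"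
      using le[OF h] by (simp add: D_def)
    have key: "2 * \<tau> * ?B h h \<le> \<tau>\<^sup>2 * D" for \<tau>
    proof -
      have "e + \<tau> *\<^sub>R h \<in> W"
        using e' h W by (simp add: subspace_add subspace_scale)
      from le[OF this] have "?B (e + \<tau> *\<^sub>R h) (?T (e + \<tau> *\<^sub>R h)) \<le> m * ?B (e + \<tau> *\<^sub>R h) (e + \<tau> *\<^sub>R h)" .
      moreover have "?B (e + \<tau> *\<^sub>R h) (?T (e + \<tau> *\<^sub>R h)) =
          m + 2 * \<tau> * ?B h (?T e) + \<tau>\<^sup>2 * ?B h (?T h)"
        using common_lines_operator_symmetric[of X e h] section_inner_commute[of X "?T e" h]
        by (simp add: linear_add[OF common_lines_operator_linear] m_def power2_eq_square
            linear_scale[OF common_lines_operator_linear] section_inner_linear algebra_simps)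
      moreover have "?B h (?T e) = ?B h h"
        using eh by (simp add: Te section_inner_linear section_inner_commute[of X h e])
      moreover have "?B (e + \<tau> *\<^sub>R h) (e + \<tau> *\<^sub>R h) = 1 + \<tau>\<^sup>2 * ?B h h"
        using e' eh section_inner_commute[of X h e]
        by (simp add: section_inner_linear power2_eq_square algebra_simps)
      ultimately show ?thesis
        by (simp add: D_def algebra_simps)
    qed
    \<comment> \<open>for small positive \<open>\<tau>\<close> the linear term wins; this value of \<open>\<tau>\<close> is small enough\<close>
    have "2 * (?B h h / (D + 1)) * ?B h h \<le> (?B h h / (D + 1))\<^sup>2 * D"
      by (rule key)
    also have "\<dots> = (?B h h / (D + 1)) * ?B h h * (D / (D + 1))"
      by (simp add: power2_eq_square)
    also have "\<dots> \<le> (?B h h / (D + 1)) * ?B h h * 1"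
      using \<open>D \<ge> 0\<close> hh by (intro mult_left_mono) auto
    finally have "0 < ?B h h / (D + 1) * ?B h h \<Longrightarrow> False"
      by simp
    then show False
      using hh \<open>D \<ge> 0\<close> by simp
  qed
  then have "e \<in> common_lines_eigenspace X m"
    using e' Te by (simp add: common_lines_eigenspace_def W_def)
  then have "e \<in> eigenspaces_above X c"
    unfolding eigenspaces_above_def using \<open>c < m\<close> by (intro span_base) auto
  then have "?B e e = 0"
    using e'(1) by (simp add: W_def)
  then show False
    using e' by simp
qed

text \<open>The constant field \<open>a\<close> projected to the planes \<open>P\<^sub>x\<close>. As a function of \<open>a\<close> this is the adjoint of
  the summation map \<open>s \<mapsto> \<Sum>\<^sub>x s(x)\<close>, see \<open>section_inner_tangent_section\<close>.\<close>

definition tangent_section :: "'a::euclidean_space set \<Rightarrow> 'a \<Rightarrow> 'a \<Rightarrow> 'a"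
  where "tangent_section X a = (\<lambda>x. if x \<in> X then a - (x \<bullet> a) *\<^sub>R x else 0)"

lemma tangent_section_mem:
  assumes "X \<subseteq> sphere 0 1"
  shows "tangent_section X a \<in> section_space X"
  using assms by (auto simp: tangent_section_def section_space_def perp_plane_def inner_diff_right
      norm_eq_1 subset_iff)

lemma section_inner_tangent_section:
  assumes "s \<in> section_space X"
  shows "section_inner X (tangent_section X a) s = a \<bullet> (\<Sum>x\<in>X. s x)"
  using assms by (simp add: section_inner_def tangent_section_def section_space_def perp_plane_def
      inner_diff_left inner_sum_right)

text \<open>Summation \<open>s \<mapsto> \<Sum>\<^sub>x s(x)\<close> is a linear isomorphism from the eigenspaces above \<open>c\<close> onto the ambient
  space. It is injective there, because the Rayleigh quotient exceeds \<open>c\<close> on those eigenspaces but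
  not on sections with zero sum. If it missed a direction, some \<open>a \<noteq> 0\<close> would be orthogonal to all
  sums, so the tangent section of \<open>a\<close> would be orthogonal to those eigenspaces and its Rayleigh
  quotient would be at most \<open>c\<close>.\<close>

lemma dim_eigenspaces_above:
  fixes X :: "'a::euclidean_space set"
  assumes "finite X" "X \<subseteq> sphere 0 1"
    and upper: "\<And>s. s \<in> section_space X \<Longrightarrow> (\<Sum>x\<in>X. s x) = 0 \<Longrightarrow>
      section_inner X s (common_lines_operator X s) \<le> c * section_inner X s s"
    and lower: "\<And>a. a \<noteq> 0 \<Longrightarrow> c * section_inner X (tangent_section X a) (tangent_section X a) <
      section_inner X (tangent_section X a) (common_lines_operator X (tangent_section X a))"
  shows "dim (eigenspaces_above X c) = DIM('a)"
proof -
  let ?V = "eigenspaces_above X c"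
  define \<Psi> where "\<Psi> = (\<lambda>s::'a \<Rightarrow> 'a. \<Sum>x\<in>X. s x)"
  have lin: "linear \<Psi>"
    by (rule linearI) (simp_all add: \<Psi>_def sum.distrib scaleR_fun_def scaleR_sum_right)
  have inj: "v = 0" if "v \<in> ?V" "\<Psi> v = 0" for v
    using rayleigh_above[OF assms(1) that(1)] upper[of v] eigenspaces_above_subset_section_space that
    unfolding \<Psi>_def by (metis linorder_not_less subsetD)
  have inj_on: "inj_on \<Psi> ?V"
    using linear_injective_on_subspace_0[OF lin subspace_eigenspaces_above] inj by blast
  have surj: "\<Psi> ` ?V = UNIV"
  proof (rule ccontr)
    assume "\<Psi> ` ?V \<noteq> UNIV"
    moreover have sub: "subspace (\<Psi> ` ?V)"
      using linear_subspace_image[OF lin subspace_eigenspaces_above] .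
    ultimately have "span (\<Psi> ` ?V) \<subset> UNIV"
      by (metis span_eq_iff top.not_eq_extremum)
    then obtain a where a: "a \<noteq> 0" "\<And>v. v \<in> \<Psi> ` ?V \<Longrightarrow> a \<bullet> v = 0"
      using span_not_UNIV_orthogonal[of "\<Psi> ` ?V"] span_base by (metis psubset_eq)
    have "section_inner X v (tangent_section X a) = 0" if "v \<in> ?V" for v
    proof -
      have "section_inner X v (tangent_section X a) = a \<bullet> \<Psi> v"
        using section_inner_tangent_section[of v X a] that eigenspaces_above_subset_section_space
        unfolding \<Psi>_def section_inner_commute[of X v] by blast
      then show ?thesis
        using a(2)[of "\<Psi> v"] that by simp
    qed
    then have "section_inner X (tangent_section X a) (common_lines_operator X (tangent_section X a)) \<le>
        c * section_inner X (tangent_section X a) (tangent_section X a)"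
      by (intro rayleigh_orthogonal_complement[OF assms(1) tangent_section_mem[OF assms(2)]])
    then show False
      using lower[OF a(1)] by linarith
  qed
  define g where "g = the_inv_into ?V \<Psi>"
  have g: "g b \<in> ?V" "\<Psi> (g b) = b" for b
    using inj_on surj the_inv_into_into[OF inj_on, of b ?V] f_the_inv_into_f[OF inj_on, of b]
    by (auto simp: g_def)
  have gg: "g (\<Psi> v) = v" if "v \<in> ?V" for v
    using the_inv_into_f_f[OF inj_on that] by (simp add: g_def)
  have gl: "linear g"
  proof (rule linearI)
    show "g (b + b') = g b + g b'" for b b'
      using gg[of "g b + g b'"] g by (simp add: linear_add[OF lin] subspace_add[OF subspace_eigenspaces_above])
    show "g (r *\<^sub>R b) = r *\<^sub>R g b" for r b
      using gg[of "r *\<^sub>R g b"] g by (simp add: linear_scale[OF lin] subspace_scale[OF subspace_eigenspaces_above])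
  qed
  have gi: "inj g"
    by (metis g(2) injI)
  have "?V = g ` UNIV"
    using g gg by (metis (no_types, lifting) UNIV_I image_eqI image_subset_iff subsetI subset_antisym)
  then have span: "span (g ` Basis) = ?V"
    by (simp add: linear_span_image[OF gl])
  have "independent (g ` Basis)"
    using linear_independent_injective_image[OF gl independent_Basis] gi by (simp add: inj_on_subset)
  moreover have "card (g ` Basis) = DIM('a)"
    using gi by (simp add: card_image inj_on_subset)
  ultimately show ?thesis
    using dim_eq_card[of "g ` Basis" ?V] span subspace_eigenspaces_above by (metis span_eq_iff)
qed

section \<open>The kernel in coordinates\<close>

text \<open>For \<open>x \<noteq> \<plusminus>y\<close> the projection of \<open>t \<in> P\<^sub>y\<close> to \<open>P\<^sub>x \<inter> P\<^sub>y\<close> removes the component along \<open>x - (x \<bullet> y) y\<close>,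
  the part of \<open>x\<close> orthogonal to \<open>y\<close>. This works in every dimension.\<close>

lemma common_line_kernel_formula:
  fixes x y s t :: "'a::euclidean_space"
  assumes "norm x = 1" "norm y = 1" "(x \<bullet> y)\<^sup>2 \<noteq> 1" "x \<bullet> s = 0" "y \<bullet> t = 0"
  shows "s \<bullet> common_line_kernel x y t = s \<bullet> t + (x \<bullet> y) * (s \<bullet> y) * (t \<bullet> x) / (1 - (x \<bullet> y)\<^sup>2)"
proof -
  define c where "c = x \<bullet> y"
  define u where "u = t - ((t \<bullet> x) / (1 - c\<^sup>2)) *\<^sub>R (x - c *\<^sub>R y)"
  have n: "x \<bullet> x = 1" "y \<bullet> y = 1" "y \<bullet> x = c" "1 - c\<^sup>2 \<noteq> 0"
    using assms by (auto simp: norm_eq_1 c_def inner_commute)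
  have "common_line_kernel x y t = u"
    unfolding common_line_kernel_def o_apply id_def
  proof (rule transpose_on_unique)
    have "x \<bullet> u = 0"
      using n by (simp add: u_def inner_diff_right inner_commute[of x t] c_def[symmetric] power2_eq_square)
    moreover have "y \<bullet> u = 0"
      using n assms(5) by (simp add: u_def inner_diff_right)
    ultimately show "u \<in> perp_plane x \<inter> perp_plane y"
      by (simp add: perp_plane_def)
    show "v \<bullet> t = v \<bullet> u" if "v \<in> perp_plane x \<inter> perp_plane y" for v
      using that by (simp add: u_def perp_plane_def inner_diff_right inner_commute[of v])
  qed (rule subspace_common_line)
  then show ?thesis
    using assms(4) by (simp add: u_def inner_diff_right c_def[symmetric] inner_commute[of s x])
qed

section \<open>The upper bound on sections with zero sum\<close>

text \<open>With \<open>z = (x \<bullet> y)\<^sup>2\<close>, the remainder in \<open>common_line_kernel_remainder\<close> acts as multiplication by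
  \<open>(5 z - 1) / 6\<close> and \<open>\<plusminus>(x \<bullet> y) / 3\<close> on two orthogonal parts, so the square of its norm is the larger of
  \<open>(5 z - 1)\<^sup>2 / 36\<close> and \<open>4 z / 36\<close>. Their sum has mean exactly \<open>1 / 9\<close> when \<open>x\<close> and \<open>y\<close> are
  uniform on the sphere, which is just not enough. The maximum is their sum minus the minimum, and
  the minimum is at least the linear function \<open>(5 z - 5 / 4) / 36\<close>, whose mean is positive. What
  remains is this quadratic polynomial, with mean \<open>43 / 432 < 1 / 9\<close>.\<close>

definition remainder_bound :: "real \<Rightarrow> real"
  where "remainder_bound z = (25 * z\<^sup>2 - 11 * z + 9 / 4) / 36"

lemma remainder_bound_ge:
  assumes "0 \<le> z" "z \<le> 1"
  shows "((5 * z - 1) / 6)\<^sup>2 \<le> remainder_bound z" "z / 9 \<le> remainder_bound z"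
proof -
  show "((5 * z - 1) / 6)\<^sup>2 \<le> remainder_bound z"
    using assms by (simp add: remainder_bound_def power2_eq_square field_simps)
  have "0 \<le> (5 * z - 3 / 2)\<^sup>2"
    by simp
  then show "z / 9 \<le> remainder_bound z"
    by (simp add: remainder_bound_def power2_eq_square field_simps)
qed

lemma two_term_cauchy_schwarz:
  fixes a b p q :: real
  assumes "0 \<le> a" "0 \<le> b" "0 \<le> p" "0 \<le> q"
  shows "sqrt a * sqrt b + sqrt p * sqrt q \<le> sqrt (a + p) * sqrt (b + q)"
  using norm_cauchy_schwarz[of "(sqrt a, sqrt p)" "(sqrt b, sqrt q)"] assms
  by (simp add: norm_Pair)

text \<open>Split \<open>P\<^sub>x\<close> and \<open>P\<^sub>y\<close> into their intersection and the orthogonal complement of the intersection. The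
  kernel is the identity on the intersection and zero on the complements. The first two terms on
  the right are the combination of the form \<open>s \<bullet> t\<close> and the triple product form
  \<open>det (s, x, y) \<cdot> det (t, x, y)\<close> (written out as a Gram determinant) that is closest to the kernel
  in mean square for uniform points of a two-dimensional sphere: this is where \<open>1 / 3\<close> and \<open>5 / 6\<close>
  come from. For a section with zero sum, summation makes the first form vanish and the second
  nonpositive. For \<open>x = \<plusminus>y\<close> the planes coincide and the triple product
  vanishes; the bound holds there as well, so neither diagonal nor antipodal pairs need separate
  treatment later.\<close>

lemma common_line_kernel_remainder:
  fixes x y s t :: "'a::euclidean_space"
  assumes xy: "norm x = 1" "norm y = 1" and st: "x \<bullet> s = 0" "y \<bullet> t = 0"
  shows "s \<bullet> common_line_kernel x y t \<le> (1 / 3) * (s \<bullet> t) +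
    (5 / 6) * ((1 - (x \<bullet> y)\<^sup>2) * (s \<bullet> t) + (x \<bullet> y) * (s \<bullet> y) * (t \<bullet> x)) +
    sqrt (remainder_bound ((x \<bullet> y)\<^sup>2)) * (norm s * norm t)"
proof -
  define c where "c = x \<bullet> y"
  define z where "z = c\<^sup>2"
  define m where "m = sqrt (remainder_bound z)"
  have n: "x \<bullet> x = 1" "y \<bullet> y = 1" "y \<bullet> x = c"
    using xy by (auto simp: norm_eq_1 c_def inner_commute)
  have "\<bar>c\<bar> \<le> 1"
    using Cauchy_Schwarz_ineq2[of x y] xy by (simp add: c_def)
  then have z: "0 \<le> z" "z \<le> 1"
    by (auto simp: z_def abs_square_le_1)
  have m: "\<bar>(5 * z - 1) / 6\<bar> \<le> m" "\<bar>c\<bar> / 3 \<le> m"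
  proof -
    show "\<bar>(5 * z - 1) / 6\<bar> \<le> m"
      unfolding m_def using remainder_bound_ge(1)[OF z] by (intro real_le_rsqrt) (simp only: power2_abs)
    have "(\<bar>c\<bar> / 3)\<^sup>2 = z / 9"
      by (simp add: z_def power2_eq_square)
    then show "\<bar>c\<bar> / 3 \<le> m"
      unfolding m_def using remainder_bound_ge(2)[OF z] by (intro real_le_rsqrt) simp
  qed
  show ?thesis
  proof (cases "z = 1")
    case True
    have "(y - c *\<^sub>R x) \<bullet> (y - c *\<^sub>R x) = 1 - c\<^sup>2"
      using n by (simp add: inner_diff_left inner_diff_right c_def[symmetric] power2_eq_square)
    then have y: "y = c *\<^sub>R x"
      using True by (simp add: z_def)
    have sy: "s \<bullet> y = 0"
      using st by (simp add: y inner_commute)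
    have "s \<bullet> common_line_kernel x y t = s \<bullet> t"
      using st sy by (intro common_line_kernel_inner) (simp_all add: perp_plane_def inner_commute)
    moreover have "(2 / 3) * (s \<bullet> t) \<le> m * (norm s * norm t)"
    proof -
      have "(2 / 3) * (s \<bullet> t) \<le> (2 / 3) * (norm s * norm t)"
        by (intro mult_left_mono norm_cauchy_schwarz) simp
      also have "\<dots> \<le> m * (norm s * norm t)"
        using m(1) True by (intro mult_right_mono) auto
      finally show ?thesis .
    qed
    ultimately show ?thesis
      using True sy by (simp add: c_def[symmetric] z_def[symmetric] m_def)
  next
    case False
    \<comment> \<open>\<open>s'\<close> and \<open>t'\<close> are the components of \<open>s\<close> and \<open>t\<close> in the intersection of the two planes\<close>
    define D where "D = 1 - z"
    have D: "D > 0"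
      using False z by (simp add: D_def)
    define P where "P = s \<bullet> y"
    define Q where "Q = t \<bullet> x"
    define s' where "s' = s - (P / D) *\<^sub>R (y - c *\<^sub>R x)"
    define t' where "t' = t - (Q / D) *\<^sub>R (x - c *\<^sub>R y)"
    have i: "s \<bullet> x = 0" "t \<bullet> y = 0" "y \<bullet> s = P" "x \<bullet> t = Q" "s \<bullet> y = P" "t \<bullet> x = Q" "x \<bullet> y = c"
      using st by (simp_all add: P_def Q_def c_def inner_commute)
    have e: "(y - c *\<^sub>R x) \<bullet> (y - c *\<^sub>R x) = D" "(x - c *\<^sub>R y) \<bullet> (x - c *\<^sub>R y) = D"
      "(y - c *\<^sub>R x) \<bullet> (x - c *\<^sub>R y) = - c * D"
      using n i by (simp_all add: inner_diff_left inner_diff_right D_def z_def power2_eq_square algebra_simps)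
    have ns: "(norm s')\<^sup>2 = (norm s)\<^sup>2 - P\<^sup>2 / D"
    proof -
      have "s' \<bullet> s' = s \<bullet> s - 2 * (P / D) * (s \<bullet> (y - c *\<^sub>R x)) + (P / D) * (P / D) * ((y - c *\<^sub>R x) \<bullet> (y - c *\<^sub>R x))"
        unfolding s'_def by (simp add: inner_diff_left inner_diff_right inner_commute algebra_simps)
      also have "\<dots> = s \<bullet> s - P\<^sup>2 / D"
        using D by (simp only: e) (simp add: inner_diff_right i power2_eq_square)
      finally show ?thesis
        by (simp add: power2_norm_eq_inner)
    qed
    have nt: "(norm t')\<^sup>2 = (norm t)\<^sup>2 - Q\<^sup>2 / D"
    proof -
      have "t' \<bullet> t' = t \<bullet> t - 2 * (Q / D) * (t \<bullet> (x - c *\<^sub>R y)) + (Q / D) * (Q / D) * ((x - c *\<^sub>R y) \<bullet> (x - c *\<^sub>R y))"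
        unfolding t'_def by (simp add: inner_diff_left inner_diff_right inner_commute algebra_simps)
      also have "\<dots> = t \<bullet> t - Q\<^sup>2 / D"
        using D by (simp only: e) (simp add: inner_diff_right i power2_eq_square)
      finally show ?thesis
        by (simp add: power2_norm_eq_inner)
    qed
    have K: "s' \<bullet> t' = s \<bullet> t + c * P * Q / D"
    proof -
      have "s' \<bullet> t' = s \<bullet> t - (Q / D) * (s \<bullet> (x - c *\<^sub>R y)) - (P / D) * (t \<bullet> (y - c *\<^sub>R x))
          + (P / D) * (Q / D) * ((y - c *\<^sub>R x) \<bullet> (x - c *\<^sub>R y))"
        unfolding s'_def t'_def
        by (simp only: inner_diff_left[of s] inner_diff_right[of _ t] inner_diff_right[of s]
            inner_diff_right[of "(P / D) *\<^sub>R (y - c *\<^sub>R x)"] inner_scaleR_left inner_scaleR_right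
            inner_commute[of "y - c *\<^sub>R x" t]) (simp add: algebra_simps)
      also have "\<dots> = s \<bullet> t + c * P * Q / D"
        using D by (simp only: e) (simp add: inner_diff_right i field_simps)
      finally show ?thesis .
    qed
    have ker: "s \<bullet> common_line_kernel x y t = s' \<bullet> t'"
      using common_line_kernel_formula[OF xy _ st] False
      by (simp add: K i z_def[symmetric] D_def)
    have "s \<bullet> common_line_kernel x y t - (1 / 3) * (s \<bullet> t) - (5 / 6) * ((1 - z) * (s \<bullet> t) + c * P * Q)
        = (5 * z - 1) / 6 * (s' \<bullet> t') + c / 3 * (P * Q / D)"
    proof -
      have st': "s \<bullet> t = s' \<bullet> t' - c * (P * Q / D)"
        by (simp add: K)
      have "c * P * Q = D * (c * (P * Q / D))"
        using D by simp
      then have "(1 - z) * (s \<bullet> t) + c * P * Q = D * (s \<bullet> t + c * (P * Q / D))"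
        by (simp only: D_def[symmetric] distrib_left)
      then have W: "(1 - z) * (s \<bullet> t) + c * P * Q = s' \<bullet> t' - z * (s' \<bullet> t')"
        by (simp add: st') (simp add: D_def left_diff_distrib)
      have "k - (1 / 3) * r - (5 / 6) * w = (5 * z - 1) / 6 * K + c / 3 * E"
        if "k = K" "r = K - c * E" "w = K - z * K" for k r w K E :: real
        unfolding that by (simp add: field_simps)
      then show ?thesis
        using ker st' W by blast
    qed
    also have "\<dots> \<le> m * (norm s' * norm t') + m * (\<bar>P\<bar> * \<bar>Q\<bar> / D)"
    proof (rule add_mono)
      have "(5 * z - 1) / 6 * (s' \<bullet> t') \<le> \<bar>(5 * z - 1) / 6\<bar> * \<bar>s' \<bullet> t'\<bar>"
        by (metis abs_ge_self abs_mult)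
      also have "\<dots> \<le> m * (norm s' * norm t')"
        using m(1) Cauchy_Schwarz_ineq2[of s' t'] by (intro mult_mono) auto
      finally show "(5 * z - 1) / 6 * (s' \<bullet> t') \<le> m * (norm s' * norm t')" .
      have "c / 3 * (P * Q / D) \<le> \<bar>c / 3\<bar> * \<bar>P * Q / D\<bar>"
        by (metis abs_ge_self abs_mult)
      also have "\<dots> \<le> m * (\<bar>P\<bar> * \<bar>Q\<bar> / D)"
        using m(2) D by (intro mult_mono) (auto simp: abs_mult)
      finally show "c / 3 * (P * Q / D) \<le> m * (\<bar>P\<bar> * \<bar>Q\<bar> / D)" .
    qed
    also have "\<dots> = m * (sqrt ((norm s')\<^sup>2) * sqrt ((norm t')\<^sup>2) + sqrt (P\<^sup>2 / D) * sqrt (Q\<^sup>2 / D))"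
      using D by (simp add: real_sqrt_divide distrib_left)
    also have "\<dots> \<le> m * (sqrt ((norm s')\<^sup>2 + P\<^sup>2 / D) * sqrt ((norm t')\<^sup>2 + Q\<^sup>2 / D))"
      using D m(2) by (intro mult_left_mono two_term_cauchy_schwarz) auto
    also have "\<dots> = m * (norm s * norm t)"
      by (simp add: ns nt)
    finally show ?thesis
      by (simp add: i z_def[symmetric] m_def)
  qed
qed

lemma lagrange_identity_Basis:
  fixes s t x y :: "'a::euclidean_space"
  shows "(\<Sum>i\<in>Basis. \<Sum>j\<in>Basis. ((s \<bullet> i) * (x \<bullet> j) - (s \<bullet> j) * (x \<bullet> i)) * ((t \<bullet> i) * (y \<bullet> j) - (t \<bullet> j) * (y \<bullet> i)))
    = 2 * ((s \<bullet> t) * (x \<bullet> y) - (s \<bullet> y) * (x \<bullet> t))"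
proof -
  have p: "(\<Sum>i\<in>Basis. \<Sum>j\<in>Basis. ((a \<bullet> i) * (b \<bullet> i)) * ((d \<bullet> j) * (e \<bullet> j))) = (a \<bullet> b) * (d \<bullet> e)"
    for a b d e :: 'a
    unfolding euclidean_inner[of a b] euclidean_inner[of d e] by (simp only: sum_product)
  have "(\<Sum>i\<in>Basis. \<Sum>j\<in>Basis. ((s \<bullet> i) * (x \<bullet> j) - (s \<bullet> j) * (x \<bullet> i)) * ((t \<bullet> i) * (y \<bullet> j) - (t \<bullet> j) * (y \<bullet> i)))
    = (\<Sum>i\<in>Basis. \<Sum>j\<in>Basis. ((s \<bullet> i) * (t \<bullet> i)) * ((x \<bullet> j) * (y \<bullet> j)) -
        ((s \<bullet> i) * (y \<bullet> i)) * ((x \<bullet> j) * (t \<bullet> j)) - ((x \<bullet> i) * (t \<bullet> i)) * ((s \<bullet> j) * (y \<bullet> j))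
        + ((x \<bullet> i) * (y \<bullet> i)) * ((s \<bullet> j) * (t \<bullet> j)))"
    by (intro sum.cong refl) (simp add: algebra_simps)
  also have "\<dots> = (s \<bullet> t) * (x \<bullet> y) - (s \<bullet> y) * (x \<bullet> t) - (x \<bullet> t) * (s \<bullet> y) + (x \<bullet> y) * (s \<bullet> t)"
    by (simp only: sum.distrib sum_subtractf p)
  finally show ?thesis
    by (simp add: algebra_simps)
qed

text \<open>By the Lagrange identity, \<open>(x \<bullet> y) ((x \<bullet> y) (s \<bullet> t) - (s \<bullet> y) (t \<bullet> x))\<close> is half the inner product of
  the tensors \<open>(s \<and> x) \<otimes> x\<close> and \<open>(t \<and> y) \<otimes> y\<close>, hence a positive semidefinite form. The triple product
  form is \<open>s \<bullet> t\<close> minus it, and \<open>s \<bullet> t\<close> contributes nothing when the sections sum to zero.\<close>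

lemma triple_product_form_nonpos:
  fixes s :: "'a::euclidean_space \<Rightarrow> 'a"
  assumes "(\<Sum>x\<in>X. s x) = 0"
  shows "(\<Sum>x\<in>X. \<Sum>y\<in>X. (1 - (x \<bullet> y)\<^sup>2) * (s x \<bullet> s y) + (x \<bullet> y) * (s x \<bullet> y) * (s y \<bullet> x)) \<le> 0"
proof -
  define T where "T = (\<lambda>i j k x. ((s x \<bullet> i) * (x \<bullet> j) - (s x \<bullet> j) * (x \<bullet> i)) * (x \<bullet> k))"
  have T: "(\<Sum>k\<in>Basis. \<Sum>i\<in>Basis. \<Sum>j\<in>Basis. T i j k x * T i j k y) =
      2 * ((x \<bullet> y)\<^sup>2 * (s x \<bullet> s y) - (x \<bullet> y) * (s x \<bullet> y) * (s y \<bullet> x))" for x y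
  proof -
    have "(\<Sum>k\<in>Basis. \<Sum>i\<in>Basis. \<Sum>j\<in>Basis. T i j k x * T i j k y) =
      (\<Sum>k\<in>Basis. (x \<bullet> k) * (y \<bullet> k) * (\<Sum>i\<in>Basis. \<Sum>j\<in>Basis. ((s x \<bullet> i) * (x \<bullet> j) - (s x \<bullet> j) * (x \<bullet> i)) *
        ((s y \<bullet> i) * (y \<bullet> j) - (s y \<bullet> j) * (y \<bullet> i))))"
      unfolding T_def sum_distrib_left by (intro sum.cong refl) (simp only: mult_ac)
    also have "\<dots> = (x \<bullet> y) * (2 * ((s x \<bullet> s y) * (x \<bullet> y) - (s x \<bullet> y) * (x \<bullet> s y)))"
      by (simp only: lagrange_identity_Basis euclidean_inner[of x y] sum_distrib_right)
    finally show ?thesis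
      by (simp add: algebra_simps power2_eq_square inner_commute)
  qed
  have "(\<Sum>x\<in>X. \<Sum>y\<in>X. s x \<bullet> s y) = (\<Sum>x\<in>X. s x) \<bullet> (\<Sum>y\<in>X. s y)"
    by (simp only: inner_sum_left, simp only: inner_sum_right)
  then have 0: "(\<Sum>x\<in>X. \<Sum>y\<in>X. s x \<bullet> s y) = 0"
    using assms by simp
  have "(\<Sum>x\<in>X. \<Sum>y\<in>X. \<Sum>k\<in>Basis. \<Sum>i\<in>Basis. \<Sum>j\<in>Basis. T i j k x * T i j k y) =
      (\<Sum>k\<in>Basis. \<Sum>i\<in>Basis. \<Sum>j\<in>Basis. (\<Sum>x\<in>X. T i j k x)\<^sup>2)"
  proof -
    have sw: "(\<Sum>x\<in>X. \<Sum>y\<in>X. \<Sum>k\<in>B. f x y k) = (\<Sum>k\<in>B. \<Sum>x\<in>X. \<Sum>y\<in>X. f x y k)"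
      for f :: "'a \<Rightarrow> 'a \<Rightarrow> 'a \<Rightarrow> real" and B
      by (simp only: sum.swap[of _ B X])
    show ?thesis
      by (simp only: sw power2_eq_square sum_product)
  qed
  also have "\<dots> \<ge> 0"
    by (intro sum_nonneg) auto
  finally have "0 \<le> (\<Sum>x\<in>X. \<Sum>y\<in>X. (x \<bullet> y)\<^sup>2 * (s x \<bullet> s y) - (x \<bullet> y) * (s x \<bullet> y) * (s y \<bullet> x))"
    by (simp only: T flip: sum_distrib_left)
  moreover have "(\<Sum>x\<in>X. \<Sum>y\<in>X. (1 - (x \<bullet> y)\<^sup>2) * (s x \<bullet> s y) + (x \<bullet> y) * (s x \<bullet> y) * (s y \<bullet> x)) =
      (\<Sum>x\<in>X. \<Sum>y\<in>X. s x \<bullet> s y) -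
      (\<Sum>x\<in>X. \<Sum>y\<in>X. (x \<bullet> y)\<^sup>2 * (s x \<bullet> s y) - (x \<bullet> y) * (s x \<bullet> y) * (s y \<bullet> x))"
    by (simp add: sum_subtractf[symmetric] algebra_simps)
  ultimately show ?thesis
    using 0 by simp
qed

lemma double_sum_cauchy_schwarz:
  fixes m :: "'b \<Rightarrow> 'b \<Rightarrow> real"
  shows "(\<Sum>x\<in>X. \<Sum>y\<in>X. m x y * (f x * f y)) \<le> sqrt (\<Sum>x\<in>X. \<Sum>y\<in>X. (m x y)\<^sup>2) * (\<Sum>x\<in>X. (f x)\<^sup>2)"
proof -
  have "(\<Sum>p\<in>X\<times>X. m (fst p) (snd p) * (f (fst p) * f (snd p)))\<^sup>2 \<le>
      (\<Sum>p\<in>X\<times>X. (m (fst p) (snd p))\<^sup>2) * (\<Sum>p\<in>X\<times>X. (f (fst p) * f (snd p))\<^sup>2)"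
    by (rule Cauchy_Schwarz_ineq_sum)
  also have "(\<Sum>p\<in>X\<times>X. (f (fst p) * f (snd p))\<^sup>2) = (\<Sum>x\<in>X. (f x)\<^sup>2)\<^sup>2"
    by (simp add: sum_product power_mult_distrib power2_eq_square[of "sum _ _"] sum.cartesian_product
        case_prod_beta)
  finally have "(\<Sum>x\<in>X. \<Sum>y\<in>X. m x y * (f x * f y))\<^sup>2 \<le>
      (\<Sum>x\<in>X. \<Sum>y\<in>X. (m x y)\<^sup>2) * (\<Sum>x\<in>X. (f x)\<^sup>2)\<^sup>2"
    by (simp add: sum.cartesian_product case_prod_beta)
  then have "\<bar>\<Sum>x\<in>X. \<Sum>y\<in>X. m x y * (f x * f y)\<bar> \<le>
      sqrt ((\<Sum>x\<in>X. \<Sum>y\<in>X. (m x y)\<^sup>2) * (\<Sum>x\<in>X. (f x)\<^sup>2)\<^sup>2)"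
    by (simp add: real_le_rsqrt)
  also have "\<dots> = sqrt (\<Sum>x\<in>X. \<Sum>y\<in>X. (m x y)\<^sup>2) * (\<Sum>x\<in>X. (f x)\<^sup>2)"
    by (simp add: real_sqrt_mult sum_nonneg)
  finally show ?thesis
    by simp
qed

text \<open>The empirical second moments, and the fourth moments with one argument repeated three times, are those of the uniform distribution on the
  two-dimensional sphere up to a relative error \<open>\<epsilon>\<close>. The bounds are uniform in the directions \<open>v\<close>
  and \<open>w\<close>, so that they can be used with \<open>v\<close> itself a point of \<open>X\<close>.\<close>

definition nearly_isotropic :: "real \<Rightarrow> 'a::euclidean_space set \<Rightarrow> bool"
  where "nearly_isotropic \<epsilon> X \<longleftrightarrow> finite X \<and> X \<noteq> {} \<and> X \<subseteq> sphere 0 1 \<and>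
    (\<forall>v w. \<bar>(\<Sum>y\<in>X. (y \<bullet> v) * (y \<bullet> w)) - real (card X) * ((v \<bullet> w) / 3)\<bar> \<le> \<epsilon> * real (card X) * (norm v * norm w)) \<and>
    (\<forall>v w. norm v = 1 \<longrightarrow> \<bar>(\<Sum>y\<in>X. (y \<bullet> v) ^ 3 * (y \<bullet> w)) - real (card X) * ((v \<bullet> w) / 5)\<bar> \<le> \<epsilon> * real (card X) * norm w)"

text \<open>The form \<open>s \<bullet> t\<close> sums to zero, the triple product form to something nonpositive, and the
  remainder to at most its Hilbert-Schmidt norm times \<open>\<bar>s\<bar>\<^sup>2\<close>; near isotropy puts that norm below
  \<open>1 / 3\<close>.\<close>

lemma rayleigh_le_third:
  fixes X :: "'a::euclidean_space set"
  assumes iso: "nearly_isotropic (1 / 1000) X"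
    and s: "s \<in> section_space X" "(\<Sum>x\<in>X. s x) = 0"
  shows "section_inner X s (common_lines_operator X s) \<le> 1 / 3 * section_inner X s s"
proof -
  define n where "n = real (card X)"
  define m where "m = (\<lambda>x y::'a. sqrt (remainder_bound ((x \<bullet> y)\<^sup>2)))"
  have n: "n > 0"
    using iso by (simp add: nearly_isotropic_def n_def card_gt_0_iff)
  have X: "norm x = 1" if "x \<in> X" for x
    using iso that by (auto simp: nearly_isotropic_def)
  have m2: "(m x y)\<^sup>2 = remainder_bound ((x \<bullet> y)\<^sup>2)" if "x \<in> X" "y \<in> X" for x y
  proof -
    have "\<bar>x \<bullet> y\<bar> \<le> 1"
      using Cauchy_Schwarz_ineq2[of x y] that X by simp
    then have "(x \<bullet> y)\<^sup>2 / 9 \<le> remainder_bound ((x \<bullet> y)\<^sup>2)"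
      by (intro remainder_bound_ge) (simp_all add: abs_square_le_1)
    moreover have "0 \<le> (x \<bullet> y)\<^sup>2 / 9"
      by simp
    ultimately have "0 \<le> remainder_bound ((x \<bullet> y)\<^sup>2)"
      by linarith
    then show ?thesis
      by (simp add: m_def)
  qed
  have row: "(\<Sum>y\<in>X. remainder_bound ((x \<bullet> y)\<^sup>2)) \<le> n / 9" if "x \<in> X" for x
  proof -
    have x: "norm x = 1" "x \<bullet> x = 1"
      using X[OF that] by (simp_all add: norm_eq_1)
    have "\<bar>(\<Sum>y\<in>X. (y \<bullet> x) * (y \<bullet> x)) - n * ((x \<bullet> x) / 3)\<bar> \<le> 1 / 1000 * n * (norm x * norm x)"
      and "\<bar>(\<Sum>y\<in>X. (y \<bullet> x) ^ 3 * (y \<bullet> x)) - n * ((x \<bullet> x) / 5)\<bar> \<le> 1 / 1000 * n * norm x"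
      using iso x(1) unfolding nearly_isotropic_def n_def by blast+
    moreover have "(\<Sum>y\<in>X. (y \<bullet> x) * (y \<bullet> x)) = (\<Sum>y\<in>X. (x \<bullet> y)\<^sup>2)"
      "(\<Sum>y\<in>X. (y \<bullet> x) ^ 3 * (y \<bullet> x)) = (\<Sum>y\<in>X. ((x \<bullet> y)\<^sup>2)\<^sup>2)"
      by (simp_all add: inner_commute power2_eq_square power3_eq_cube mult.assoc)
    ultimately have moments: "\<bar>(\<Sum>y\<in>X. (x \<bullet> y)\<^sup>2) - n * (1 / 3)\<bar> \<le> 1 / 1000 * n"
      "\<bar>(\<Sum>y\<in>X. ((x \<bullet> y)\<^sup>2)\<^sup>2) - n * (1 / 5)\<bar> \<le> 1 / 1000 * n"
      unfolding x by simp_all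
    have sum: "(\<Sum>y\<in>X. remainder_bound ((x \<bullet> y)\<^sup>2)) =
        (25 * (\<Sum>y\<in>X. ((x \<bullet> y)\<^sup>2)\<^sup>2) - 11 * (\<Sum>y\<in>X. (x \<bullet> y)\<^sup>2) + n * (9 / 4)) / 36"
      by (simp add: remainder_bound_def sum.distrib sum_subtractf sum_distrib_left n_def
          flip: sum_divide_distrib)
    have "r \<le> n / 9" if "\<bar>p - n * (1 / 3)\<bar> \<le> 1 / 1000 * n" "\<bar>q - n * (1 / 5)\<bar> \<le> 1 / 1000 * n"
      "r = (25 * q - 11 * p + n * (9 / 4)) / 36" for p q r
    proof -
      have "r * 36 = 25 * q - 11 * p + n * (9 / 4)"
        using that(3) by simp
      then show ?thesis
        using abs_le_D2[OF that(1)] abs_le_D1[OF that(2)] n by linarith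
    qed
    from this[OF moments sum] show ?thesis .
  qed
  have "(\<Sum>x\<in>X. \<Sum>y\<in>X. (m x y)\<^sup>2) \<le> (\<Sum>x\<in>X. n / 9)"
    using row by (intro sum_mono) (simp add: m2)
  also have "\<dots> = (n / 3)\<^sup>2"
    by (simp add: n_def power2_eq_square)
  finally have HS: "sqrt (\<Sum>x\<in>X. \<Sum>y\<in>X. (m x y)\<^sup>2) \<le> n / 3"
    using n by (intro real_le_lsqrt) auto
  define \<tau> where "\<tau> = (\<lambda>x y. (1 - (x \<bullet> y)\<^sup>2) * (s x \<bullet> s y) + (x \<bullet> y) * (s x \<bullet> y) * (s y \<bullet> x))"
  have "(\<Sum>x\<in>X. \<Sum>y\<in>X. s x \<bullet> common_line_kernel x y (s y)) \<le>
      (\<Sum>x\<in>X. \<Sum>y\<in>X. (1 / 3) * (s x \<bullet> s y) + (5 / 6) * \<tau> x y + m x y * (norm (s x) * norm (s y)))"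
    unfolding m_def \<tau>_def using s(1)
    by (intro sum_mono common_line_kernel_remainder X) (auto simp: section_space_def perp_plane_def)
  also have "\<dots> = (1 / 3) * (\<Sum>x\<in>X. \<Sum>y\<in>X. s x \<bullet> s y) + (5 / 6) * (\<Sum>x\<in>X. \<Sum>y\<in>X. \<tau> x y) +
      (\<Sum>x\<in>X. \<Sum>y\<in>X. m x y * (norm (s x) * norm (s y)))"
    by (simp only: sum.distrib sum_distrib_left)
  also have "(\<Sum>x\<in>X. \<Sum>y\<in>X. s x \<bullet> s y) = (\<Sum>x\<in>X. s x) \<bullet> (\<Sum>y\<in>X. s y)"
    by (simp only: inner_sum_left, simp only: inner_sum_right)
  also have "\<dots> = 0"
    by (simp add: s(2))
  also have "(\<Sum>x\<in>X. \<Sum>y\<in>X. m x y * (norm (s x) * norm (s y))) \<le>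
      sqrt (\<Sum>x\<in>X. \<Sum>y\<in>X. (m x y)\<^sup>2) * (\<Sum>x\<in>X. (norm (s x))\<^sup>2)"
    by (rule double_sum_cauchy_schwarz)
  also have "\<dots> \<le> n / 3 * (\<Sum>x\<in>X. (norm (s x))\<^sup>2)"
    using HS by (intro mult_right_mono sum_nonneg) auto
  also have "(\<Sum>x\<in>X. (norm (s x))\<^sup>2) = section_inner X s s"
    by (simp add: section_inner_def power2_norm_eq_inner)
  finally have "(\<Sum>x\<in>X. \<Sum>y\<in>X. s x \<bullet> common_line_kernel x y (s y)) \<le> n / 3 * section_inner X s s"
    using triple_product_form_nonpos[OF s(2)] by (simp add: \<tau>_def)
  then show ?thesis
    using n by (simp add: section_inner_operator n_def[symmetric] field_simps)
qed

section \<open>The lower bound on projected constant fields\<close>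

text \<open>The right-hand side is the squared length of the projection of \<open>a\<close> to \<open>P\<^sub>x \<inter> P\<^sub>y\<close>, which equals the
  Gram determinant \<open>G\<close> of \<open>a, x, y\<close> divided by \<open>1 - (x \<bullet> y)\<^sup>2\<close>. The estimate
  \<open>1 / (1 - z) \<ge> 1 + z\<close> makes it a polynomial. Its first term alone would give exactly the
  Rayleigh quotient \<open>1 / 3\<close> in the limit, so the second one is needed for a strict inequality.\<close>

lemma common_line_kernel_tangent_ge:
  fixes x y a :: "'a::euclidean_space"
  assumes xy: "norm x = 1" "norm y = 1"
  shows "(1 + (x \<bullet> y)\<^sup>2) * ((a \<bullet> a) * (1 - (x \<bullet> y)\<^sup>2) + 2 * (x \<bullet> y) * (x \<bullet> a) * (y \<bullet> a) - (x \<bullet> a)\<^sup>2 - (y \<bullet> a)\<^sup>2)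
    \<le> (a - (x \<bullet> a) *\<^sub>R x) \<bullet> common_line_kernel x y (a - (y \<bullet> a) *\<^sub>R y)"
proof -
  define c where "c = x \<bullet> y"
  define G where "G = (a \<bullet> a) * (1 - c\<^sup>2) + 2 * c * (x \<bullet> a) * (y \<bullet> a) - (x \<bullet> a)\<^sup>2 - (y \<bullet> a)\<^sup>2"
  let ?s = "a - (x \<bullet> a) *\<^sub>R x" and ?t = "a - (y \<bullet> a) *\<^sub>R y"
  define p where "p = common_line_kernel x y ?t"
  have n: "x \<bullet> x = 1" "y \<bullet> y = 1" "y \<bullet> x = c" "x \<bullet> y = c"
    using xy by (auto simp: norm_eq_1 c_def inner_commute)
  have p: "p \<bullet> x = 0" "p \<bullet> y = 0"
    using common_line_kernel_mem[of x y ?t] by (simp_all add: p_def perp_plane_def inner_commute)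
  have "p \<bullet> p = p \<bullet> ?t"
    using common_line_kernel_inner[of p x y ?t] p by (simp add: p_def perp_plane_def inner_commute)
  also have "\<dots> = ?s \<bullet> p"
    using p by (simp add: inner_diff_left inner_diff_right inner_commute)
  finally have nonneg: "0 \<le> ?s \<bullet> p"
    using inner_ge_zero[of p] by simp
  have "\<bar>c\<bar> \<le> 1"
    using Cauchy_Schwarz_ineq2[of x y] xy by (simp add: c_def)
  then have c: "c\<^sup>2 \<le> 1"
    by (simp add: abs_square_le_1)
  have "(1 + c\<^sup>2) * G \<le> ?s \<bullet> p"
  proof (cases "c\<^sup>2 = 1")
    case True
    then have "c = 1 \<or> c = - 1"
      by (simp add: power2_eq_1_iff)
    then have "G = - (x \<bullet> a - c * (y \<bullet> a))\<^sup>2"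
      by (auto simp: G_def power2_eq_square algebra_simps)
    then have "(1 + c\<^sup>2) * G \<le> 0"
      using True by simp
    then show ?thesis
      using nonneg by simp
  next
    case False
    then have D: "1 - c\<^sup>2 > 0"
      using c by simp
    have "?s \<bullet> p = ?s \<bullet> ?t + c * (?s \<bullet> y) * (?t \<bullet> x) / (1 - c\<^sup>2)"
      unfolding p_def using common_line_kernel_formula[OF xy, of ?s ?t] False n
      by (simp add: inner_diff_right)
    then have "(1 - c\<^sup>2) * (?s \<bullet> p) = (1 - c\<^sup>2) * (?s \<bullet> ?t) + c * (?s \<bullet> y) * (?t \<bullet> x)"
      using D by (simp add: distrib_left)
    also have "\<dots> = G"
    proof -
      have "?s \<bullet> ?t = a \<bullet> a - (x \<bullet> a)\<^sup>2 - (y \<bullet> a)\<^sup>2 + c * (x \<bullet> a) * (y \<bullet> a)"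
        using n by (simp add: inner_diff_left inner_diff_right inner_commute[of a x]
            inner_commute[of a y] power2_eq_square right_diff_distrib mult_ac)
      moreover have "?s \<bullet> y = y \<bullet> a - c * (x \<bullet> a)" "?t \<bullet> x = x \<bullet> a - c * (y \<bullet> a)"
        using n by (simp_all add: inner_diff_left inner_commute[of a x] inner_commute[of a y])
      ultimately show ?thesis
        unfolding G_def by (simp only:) (simp add: power2_eq_square algebra_simps)
    qed
    finally have G: "G = (1 - c\<^sup>2) * (?s \<bullet> p)" ..
    have "(1 + c\<^sup>2) * G = (1 - c ^ 4) * (?s \<bullet> p)"
      by (simp add: G algebra_simps power2_eq_square power4_eq_xxxx)
    also have "\<dots> \<le> 1 * (?s \<bullet> p)"
      using nonneg by (intro mult_right_mono) auto
    finally show ?thesis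
      by simp
  qed
  then show ?thesis
    by (simp add: G_def p_def c_def)
qed

text \<open>Normalise \<open>\<bar>a\<bar> = 1\<close>. For uniform points the polynomial lower bound has mean \<open>4 / 15\<close>, and the
  squared length of the projection of \<open>a\<close> to \<open>P\<^sub>x\<close> has mean \<open>2 / 3\<close>; strictness comes from
  \<open>4 / 15 > (1 / 3) \<cdot> (2 / 3)\<close>. The error terms in the moments only consume part of this gap.\<close>

lemma rayleigh_tangent_gt_third:
  fixes X :: "'a::euclidean_space set"
  assumes iso: "nearly_isotropic (1 / 1000) X" and a: "a \<noteq> 0"
  shows "1 / 3 * section_inner X (tangent_section X a) (tangent_section X a) <
    section_inner X (tangent_section X a) (common_lines_operator X (tangent_section X a))"
proof -
  define n where "n = real (card X)"
  define A where "A = a \<bullet> a"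
  define \<epsilon> :: real where "\<epsilon> = 1 / 1000"
  have A: "A > 0" "norm a * norm a = A"
    using a by (simp_all add: A_def dot_square_norm power2_eq_square)
  have n: "n > 0"
    using iso by (simp add: nearly_isotropic_def n_def card_gt_0_iff)
  have X: "norm x = 1" if "x \<in> X" for x
    using iso that by (auto simp: nearly_isotropic_def)
  have iso2: "\<bar>(\<Sum>y\<in>X. (y \<bullet> v) * (y \<bullet> w)) - n * ((v \<bullet> w) / 3)\<bar> \<le> \<epsilon> * n * (norm v * norm w)" for v w
    using iso by (simp add: nearly_isotropic_def n_def \<epsilon>_def)
  have iso4: "\<bar>(\<Sum>y\<in>X. (y \<bullet> v) ^ 3 * (y \<bullet> w)) - n * ((v \<bullet> w) / 5)\<bar> \<le> \<epsilon> * n * norm w" if "norm v = 1" for v w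
    using iso that unfolding nearly_isotropic_def n_def \<epsilon>_def by blast
  define S where "S = (\<Sum>x\<in>X. (x \<bullet> a)\<^sup>2)"
  have S: "n * A * (1 / 3 - \<epsilon>) \<le> S" "S \<le> n * A * (1 / 3 + \<epsilon>)"
    using iso2[of a a] by (simp_all add: A S_def power2_eq_square A_def[symmetric] abs_le_iff algebra_simps)
  have c2: "(\<Sum>y\<in>X. (x \<bullet> y)\<^sup>2) \<le> n * (1 / 3 + \<epsilon>)" if "x \<in> X" for x
    using iso2[of x x] X[OF that]
    by (simp add: power2_eq_square abs_le_iff algebra_simps inner_commute norm_eq_1)
  have c4: "(\<Sum>y\<in>X. (x \<bullet> y) ^ 4) \<le> n * (1 / 5 + \<epsilon>)" if "x \<in> X" for x
  proof -
    have "(\<Sum>y\<in>X. (y \<bullet> x) ^ 3 * (y \<bullet> x)) = (\<Sum>y\<in>X. (x \<bullet> y) ^ 4)"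
      by (simp add: inner_commute power4_eq_xxxx power3_eq_cube)
    moreover have "x \<bullet> x = 1"
      using X[OF that] by (simp add: norm_eq_1)
    ultimately show ?thesis
      using iso4[of x x] X[OF that] by (simp add: abs_le_iff algebra_simps)
  qed
  have cross: "(x \<bullet> a)\<^sup>2 * n * k - \<epsilon> * n * A \<le> (\<Sum>y\<in>X. (x \<bullet> a) * f y)"
    if "x \<in> X" "\<bar>sum f X - n * ((x \<bullet> a) * k)\<bar> \<le> \<epsilon> * n * norm a" for x f and k :: real
  proof -
    have xa: "\<bar>x \<bullet> a\<bar> \<le> norm a"
      using Cauchy_Schwarz_ineq2[of x a] X[OF that(1)] by simp
    have "\<bar>(x \<bullet> a) * (sum f X - n * ((x \<bullet> a) * k))\<bar> \<le> norm a * (\<epsilon> * n * norm a)"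
      unfolding abs_mult using xa that(2) by (intro mult_mono) auto
    then have "- (\<epsilon> * n * A) \<le> (x \<bullet> a) * (sum f X - n * ((x \<bullet> a) * k))"
      using A(2) by (simp add: abs_le_iff algebra_simps)
    then have "(x \<bullet> a)\<^sup>2 * n * k - \<epsilon> * n * A \<le> (x \<bullet> a) * sum f X"
      by (simp add: algebra_simps power2_eq_square)
    then show ?thesis
      by (simp add: sum_distrib_left)
  qed
  have cross1: "(x \<bullet> a)\<^sup>2 * n * (1 / 3) - \<epsilon> * n * A \<le> (\<Sum>y\<in>X. (x \<bullet> a) * ((y \<bullet> x) * (y \<bullet> a)))" if "x \<in> X" for x
    using iso2[of x a] X[OF that] that by (intro cross) auto
  have cross3: "(x \<bullet> a)\<^sup>2 * n * (1 / 5) - \<epsilon> * n * A \<le> (\<Sum>y\<in>X. (x \<bullet> a) * ((y \<bullet> x) ^ 3 * (y \<bullet> a)))" if "x \<in> X" for x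
    using iso4[of x a] X[OF that] that by (intro cross) auto
  \<comment> \<open>the polynomial lower bound, expanded so that each sum over \<open>y\<close> is a known moment\<close>
  define g where "g = (\<lambda>x y. (1 + (x \<bullet> y)\<^sup>2) * (A * (1 - (x \<bullet> y)\<^sup>2) + 2 * (x \<bullet> y) * (x \<bullet> a) * (y \<bullet> a) - (x \<bullet> a)\<^sup>2 - (y \<bullet> a)\<^sup>2))"
  have "(\<Sum>x\<in>X. \<Sum>y\<in>X. g x y) = (\<Sum>x\<in>X. \<Sum>y\<in>X. A - A * (x \<bullet> y) ^ 4
      + 2 * ((x \<bullet> a) * ((y \<bullet> x) * (y \<bullet> a))) + 2 * ((x \<bullet> a) * ((y \<bullet> x) ^ 3 * (y \<bullet> a)))
      - (x \<bullet> a)\<^sup>2 - (x \<bullet> a)\<^sup>2 * (x \<bullet> y)\<^sup>2 - (y \<bullet> a)\<^sup>2 * (1 + (y \<bullet> x)\<^sup>2))"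
  proof (intro sum.cong refl)
    fix x y
    show "g x y = A - A * (x \<bullet> y) ^ 4
      + 2 * ((x \<bullet> a) * ((y \<bullet> x) * (y \<bullet> a))) + 2 * ((x \<bullet> a) * ((y \<bullet> x) ^ 3 * (y \<bullet> a)))
      - (x \<bullet> a)\<^sup>2 - (x \<bullet> a)\<^sup>2 * (x \<bullet> y)\<^sup>2 - (y \<bullet> a)\<^sup>2 * (1 + (y \<bullet> x)\<^sup>2)"
      unfolding g_def inner_commute[of y x]
      by (simp add: power2_eq_square power3_eq_cube power4_eq_xxxx algebra_simps)
  qed
  also have "\<dots> = n * n * A - A * (\<Sum>x\<in>X. \<Sum>y\<in>X. (x \<bullet> y) ^ 4)
      + 2 * (\<Sum>x\<in>X. \<Sum>y\<in>X. (x \<bullet> a) * ((y \<bullet> x) * (y \<bullet> a)))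
      + 2 * (\<Sum>x\<in>X. \<Sum>y\<in>X. (x \<bullet> a) * ((y \<bullet> x) ^ 3 * (y \<bullet> a)))
      - 2 * (n * S + (\<Sum>x\<in>X. (x \<bullet> a)\<^sup>2 * (\<Sum>y\<in>X. (x \<bullet> y)\<^sup>2)))"
  proof -
    have "(\<Sum>x\<in>X. \<Sum>y\<in>X. (y \<bullet> a)\<^sup>2 * (1 + (y \<bullet> x)\<^sup>2)) = n * S + (\<Sum>x\<in>X. (x \<bullet> a)\<^sup>2 * (\<Sum>y\<in>X. (x \<bullet> y)\<^sup>2))"
      by (subst sum.swap) (simp add: distrib_left sum.distrib sum_distrib_left[symmetric]
          sum_distrib_right[symmetric] S_def n_def mult.commute)
    then show ?thesis
      by (simp add: sum.distrib sum_subtractf S_def n_def flip: sum_distrib_left)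
  qed
  finally have g: "(\<Sum>x\<in>X. \<Sum>y\<in>X. g x y) = \<dots>" .
  have b4: "(\<Sum>x\<in>X. \<Sum>y\<in>X. (x \<bullet> y) ^ 4) \<le> n * n * (1 / 5 + \<epsilon>)"
    using sum_mono[of X "\<lambda>x. \<Sum>y\<in>X. (x \<bullet> y) ^ 4" "\<lambda>_. n * (1 / 5 + \<epsilon>)"] c4 by (simp add: n_def mult.assoc)
  have b1: "S * n * (1 / 3) - \<epsilon> * n * A * n \<le> (\<Sum>x\<in>X. \<Sum>y\<in>X. (x \<bullet> a) * ((y \<bullet> x) * (y \<bullet> a)))"
    using sum_mono[of X "\<lambda>x. (x \<bullet> a)\<^sup>2 * n * (1 / 3) - \<epsilon> * n * A", OF cross1]
    unfolding S_def sum_distrib_right by (simp add: sum_subtractf n_def mult_ac)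
  have b3: "S * n * (1 / 5) - \<epsilon> * n * A * n \<le> (\<Sum>x\<in>X. \<Sum>y\<in>X. (x \<bullet> a) * ((y \<bullet> x) ^ 3 * (y \<bullet> a)))"
    using sum_mono[of X "\<lambda>x. (x \<bullet> a)\<^sup>2 * n * (1 / 5) - \<epsilon> * n * A", OF cross3]
    unfolding S_def sum_distrib_right by (simp add: sum_subtractf n_def mult_ac)
  have b2: "(\<Sum>x\<in>X. (x \<bullet> a)\<^sup>2 * (\<Sum>y\<in>X. (x \<bullet> y)\<^sup>2)) \<le> S * (n * (1 / 3 + \<epsilon>))"
    unfolding S_def sum_distrib_right by (intro sum_mono mult_left_mono c2) auto
  have A4: "A * (\<Sum>x\<in>X. \<Sum>y\<in>X. (x \<bullet> y) ^ 4) \<le> A * (n * n * (1 / 5 + \<epsilon>))"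
    using b4 A by (intro mult_left_mono) auto
  have nS: "n * S \<le> n * (n * A * (1 / 3 + \<epsilon>))"
    using S n by (intro mult_left_mono) auto
  have nS': "n * (n * A * (1 / 3 - \<epsilon>)) \<le> n * S"
    using S n by (intro mult_left_mono) auto
  define u where "u = n * n * A"
  have u: "u > 0"
    using n A by (simp add: u_def)
  have "n * (n * A - S) * (1 / 3) < (\<Sum>x\<in>X. \<Sum>y\<in>X. g x y)"
  proof -
    define w where "w = n * S"
    have "u * (1 / 3 - \<epsilon>) \<le> w" "w \<le> u * (1 / 3 + \<epsilon>)"
      using nS nS' by (simp_all add: u_def w_def mult_ac)
    moreover have "(\<Sum>x\<in>X. \<Sum>y\<in>X. g x y) \<ge> u - u * (1 / 5 + \<epsilon>) + 2 * (w * (1 / 3) - \<epsilon> * u)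
        + 2 * (w * (1 / 5) - \<epsilon> * u) - 2 * (w + w * (1 / 3 + \<epsilon>))"
      unfolding g using A4 b1 b3 b2 by (simp add: u_def w_def algebra_simps)
    moreover have "n * (n * A - S) * (1 / 3) = (u - w) * (1 / 3)"
      by (simp add: u_def w_def algebra_simps)
    ultimately show ?thesis
      using u by (simp add: \<epsilon>_def)
  qed
  also have "\<dots> \<le> (\<Sum>x\<in>X. \<Sum>y\<in>X. tangent_section X a x \<bullet> common_line_kernel x y (tangent_section X a y))"
    unfolding g_def A_def by (intro sum_mono) (simp add: tangent_section_def common_line_kernel_tangent_ge X)
  finally have "(n * A - S) * (1 / 3) <
      section_inner X (tangent_section X a) (common_lines_operator X (tangent_section X a))"
    using n by (simp add: section_inner_operator n_def[symmetric] field_simps)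
  moreover have "section_inner X (tangent_section X a) (tangent_section X a) = n * A - S"
  proof -
    have "tangent_section X a x \<bullet> tangent_section X a x = A - (x \<bullet> a)\<^sup>2" if "x \<in> X" for x
    proof -
      have "x \<bullet> x = 1"
        using X[OF that] by (simp add: norm_eq_1)
      then show ?thesis
        using that by (simp add: tangent_section_def A_def inner_diff_left inner_diff_right
            inner_commute[of a x] power2_eq_square)
    qed
    then show ?thesis
      by (simp add: section_inner_def sum_subtractf S_def n_def)
  qed
  ultimately show ?thesis
    by (simp add: mult.commute)
qed

theorem dim_eigenspaces_above_third:
  fixes X :: "'a::euclidean_space set"
  assumes "nearly_isotropic (1 / 1000) X"
  shows "dim (eigenspaces_above X (1 / 3)) = DIM('a)"
  by (rule dim_eigenspaces_above)
    (use assms rayleigh_le_third[OF assms] rayleigh_tangent_gt_third[OF assms] in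
      \<open>auto simp: nearly_isotropic_def\<close>)

section \<open>Rotation invariance of the uniform distribution on the sphere\<close>

text \<open>Invariance of Lebesgue measure under orthogonal maps is a statement about determinants, hence about
  matrices. This lemma identifies a three-dimensional Euclidean space with \<open>real^3\<close> as a measure space
  by matching the orthonormal bases.\<close>

lemma lborel_eq_distr_vec:
  fixes \<beta> :: "3 \<Rightarrow> 'a::euclidean_space"
  assumes \<beta>: "bij_betw \<beta> UNIV Basis"
  defines "g \<equiv> \<lambda>z::real^3. \<Sum>i\<in>UNIV. (z $ i) *\<^sub>R \<beta> i"
  shows "(lborel :: 'a measure) = distr lborel borel g"
proof (rule lborel_eqI)
  have [measurable]: "g \<in> borel_measurable borel"
    unfolding g_def by (intro borel_measurable_continuous_onI continuous_intros)
  have g: "g z \<bullet> \<beta> j = z $ j" for z j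
  proof -
    have "g z \<bullet> \<beta> j = (\<Sum>i\<in>UNIV. if i = j then z $ j else 0)"
      unfolding g_def inner_sum_left
    proof (intro sum.cong refl)
      fix i
      have "\<beta> i \<in> Basis" "\<beta> j \<in> Basis" "\<beta> i = \<beta> j \<longleftrightarrow> i = j"
        using \<beta> by (auto simp: bij_betw_def inj_eq)
      then show "(z $ i) *\<^sub>R \<beta> i \<bullet> \<beta> j = (if i = j then z $ j else 0)"
        by (simp add: inner_Basis)
    qed
    then show ?thesis
      by simp
  qed
  show "sets (distr lborel borel g) = sets borel"
    by simp
  fix l u :: 'a
  assume lu: "\<And>b. b \<in> Basis \<Longrightarrow> l \<bullet> b \<le> u \<bullet> b"
  let ?l = "(\<chi> i. l \<bullet> \<beta> i) :: real^3" and ?u = "(\<chi> i. u \<bullet> \<beta> i) :: real^3"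
  have B: "Basis = range \<beta>"
    using \<beta> by (simp add: bij_betw_def)
  have "g -` box l u = box ?l ?u"
    by (auto simp: mem_box_cart) (auto simp: mem_box B g)
  then have "emeasure (distr lborel borel g) (box l u) = emeasure lborel (box ?l ?u)"
    by (simp add: emeasure_distr)
  also have "\<dots> = (\<Prod>b\<in>Basis. (?u - ?l) \<bullet> b)"
    using lu by (intro emeasure_lborel_box) (auto simp: Basis_vec_def inner_axis B)
  also have "(\<Prod>b\<in>Basis. (?u - ?l) \<bullet> b) = (\<Prod>i\<in>UNIV. (?u - ?l) \<bullet> axis i 1)"
    by (rule prod.reindex_bij_betw[symmetric])
      (auto simp: bij_betw_def inj_on_def axis_eq_axis Basis_vec_def)
  also have "\<dots> = (\<Prod>i\<in>UNIV. (u - l) \<bullet> \<beta> i)"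
    by (simp add: inner_axis inner_diff_left)
  also have "\<dots> = (\<Prod>b\<in>Basis. (u - l) \<bullet> b)"
    using \<beta> by (rule prod.reindex_bij_betw)
  finally show "emeasure (distr lborel borel g) (box l u) = (\<Prod>b\<in>Basis. (u - l) \<bullet> b)" .
qed

lemma lborel_orthogonal_invariant_vec:
  fixes Q :: "real^'n::{finite,wellorder} \<Rightarrow> real^'n::_"
  assumes Q: "orthogonal_transformation Q"
  shows "distr lborel borel Q = lborel"
proof (rule lborel_eqI[symmetric])
  have lin: "linear Q" and bij: "bij Q"
    using Q by (simp_all add: orthogonal_transformation_linear orthogonal_transformation_bij)
  have [measurable]: "Q \<in> borel_measurable borel"
    using lin by (intro borel_measurable_continuous_onI linear_continuous_on) (simp add: linear_conv_bounded_linear)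
  have inv: "orthogonal_transformation (inv Q)"
    using Q by (rule orthogonal_transformation_inv)
  fix l u :: "real^'n::_"
  assume lu: "\<And>b. b \<in> Basis \<Longrightarrow> l \<bullet> b \<le> u \<bullet> b"
  have eq: "Q -` box l u = inv Q ` box l u"
    using bij by (simp add: bij_vimage_eq_inv_image)
  have box: "box l u \<in> lmeasurable"
    by simp
  have im: "inv Q ` box l u \<in> lmeasurable"
    using inv box by (intro measurable_linear_image) (simp_all add: orthogonal_transformation_linear)
  have "measure lebesgue (inv Q ` box l u) = measure lebesgue (box l u)"
    using measure_linear_image[OF orthogonal_transformation_linear[OF inv] box]
      orthogonal_transformation_det[OF inv] by simp
  then have "emeasure lebesgue (inv Q ` box l u) = emeasure lebesgue (box l u)"
    using box im by (metis emeasure_eq_measure2 fmeasurableD2)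
  moreover have "inv Q ` box l u \<in> sets borel"
    unfolding eq[symmetric] using measurable_sets_borel[of Q borel "box l u"] by simp
  ultimately have "emeasure (distr lborel borel Q) (box l u) = emeasure lborel (box l u)"
    by (simp add: emeasure_distr eq)
  then show "emeasure (distr lborel borel Q) (box l u) = (\<Prod>b\<in>Basis. (u - l) \<bullet> b)"
    using lu by simp
qed simp

lemma lborel_orthogonal_invariant:
  fixes T :: "'a::euclidean_space \<Rightarrow> 'a"
  assumes dim: "DIM('a) = 3" and T: "orthogonal_transformation T"
  shows "distr lborel borel T = lborel"
proof -
  have "card (UNIV :: 3 set) = card (Basis :: 'a set)"
    using dim by simp
  then obtain \<beta> :: "3 \<Rightarrow> 'a" where \<beta>: "bij_betw \<beta> UNIV Basis"
    by (meson finite finite_Basis bij_betw_iff_card)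
  have B: "Basis = range \<beta>" "inj \<beta>"
    using \<beta> by (simp_all add: bij_betw_def)
  define g where "g = (\<lambda>z::real^3. \<Sum>i\<in>UNIV. (z $ i) *\<^sub>R \<beta> i)"
  define h where "h = (\<lambda>x::'a. (\<chi> i. x \<bullet> \<beta> i) :: real^3)"
  have lg: "linear g"
    by (rule linearI) (simp_all add: g_def scaleR_add_left sum.distrib scaleR_sum_right)
  have lh: "linear h"
    by (rule linearI) (simp_all add: h_def vec_eq_iff inner_add_left)
  have gh: "g (h x) = x" for x
  proof -
    have "g (h x) = (\<Sum>b\<in>Basis. (x \<bullet> b) *\<^sub>R b)"
      unfolding g_def h_def vec_lambda_beta using \<beta> by (rule sum.reindex_bij_betw)
    then show ?thesis
      by (simp add: euclidean_representation)
  qed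
  have hh: "h x \<bullet> h y = x \<bullet> y" for x y
  proof -
    have "h x \<bullet> h y = (\<Sum>i\<in>UNIV. (x \<bullet> \<beta> i) * (y \<bullet> \<beta> i))"
      by (simp add: h_def inner_vec_def)
    also have "\<dots> = (\<Sum>b\<in>Basis. (x \<bullet> b) * (y \<bullet> b))"
      using \<beta> by (rule sum.reindex_bij_betw)
    finally show ?thesis
      by (simp add: euclidean_inner[of x y])
  qed
  have hg: "h (g z) = z" for z
  proof -
    have "inj h"
      using gh by (metis injI)
    then have "surj h"
      using linear_injective_imp_surjective[OF lh] dim by simp
    then obtain x where "z = h x"
      by blast
    then show ?thesis
      by (simp add: gh)
  qed
  have T': "linear T" "\<And>x y. T x \<bullet> T y = x \<bullet> y"
    using T by (auto simp: orthogonal_transformation_def)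
  have gg: "g z \<bullet> g w = z \<bullet> w" for z w
    using hh[of "g z" "g w"] by (simp add: hg)
  define Q where "Q = h \<circ> T \<circ> g"
  have Q: "orthogonal_transformation Q"
    unfolding orthogonal_transformation_def Q_def using lg lh T'
    by (auto simp: hh gg intro!: linear_compose)
  have meas [measurable]: "g \<in> borel_measurable borel" "T \<in> borel_measurable borel" "Q \<in> borel_measurable borel"
    using lg T'(1) Q
    by (auto intro!: borel_measurable_continuous_onI linear_continuous_on
        simp: linear_conv_bounded_linear dest: orthogonal_transformation_linear)
  have lb: "(lborel :: 'a measure) = distr lborel borel g"
    unfolding g_def by (rule lborel_eq_distr_vec[OF \<beta>])
  have "distr (lborel :: 'a measure) borel T = distr (distr lborel borel g) borel T"
    using lb by simp
  also have "\<dots> = distr lborel borel (T \<circ> g)"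
    by (rule distr_distr) simp_all
  also have "T \<circ> g = g \<circ> Q"
    by (auto simp: Q_def gh)
  also have "distr lborel borel (g \<circ> Q) = distr (distr lborel borel Q) borel g"
    by (rule distr_distr[symmetric]) simp_all
  also have "\<dots> = lborel"
    using lb by (simp add: lborel_orthogonal_invariant_vec[OF Q])
  finally show ?thesis .
qed

lemma sgn_borel_measurable [measurable]:
  "(sgn :: 'a::euclidean_space \<Rightarrow> 'a) \<in> borel_measurable borel"
  unfolding sgn_div_norm by measurable

lemma emeasure_ball_nontrivial:
  "emeasure lborel (ball (0::'a::euclidean_space) 1) \<noteq> 0" "emeasure lborel (ball (0::'a) 1) \<noteq> \<infinity>"
  using emeasure_lborel_ball_finite[of "0::'a" 1] content_ball_pos[of 1 "0::'a"]
  by (auto simp: less_top measure_def)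

lemma prob_space_uniform_sphere: "prob_space (uniform_sphere :: 'a::euclidean_space measure)"
  unfolding uniform_sphere_def
  by (intro prob_space.prob_space_distr prob_space_uniform_measure emeasure_ball_nontrivial) simp

lemma sets_uniform_sphere [simp, measurable_cong]: "sets uniform_sphere = sets borel"
  by (simp add: uniform_sphere_def)

lemma space_uniform_sphere [simp]: "space uniform_sphere = UNIV"
  by (simp add: uniform_sphere_def)

lemma null_uniform_sphere:
  assumes "A \<in> sets borel" "emeasure lborel (sgn -` A) = 0"
  shows "emeasure uniform_sphere (A :: 'a::euclidean_space set) = 0"
proof -
  have m: "sgn -` A \<in> sets borel"
    using measurable_sets_borel[OF sgn_borel_measurable assms(1)] .
  have "emeasure uniform_sphere A = emeasure (uniform_measure lborel (ball 0 1)) (sgn -` A)"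
    using assms(1) by (simp add: uniform_sphere_def emeasure_distr)
  also have "\<dots> = emeasure lborel (ball 0 1 \<inter> sgn -` A) / emeasure lborel (ball (0::'a) 1)"
    using m by simp
  also have "emeasure lborel (ball 0 1 \<inter> sgn -` A) = 0"
    using emeasure_mono[of "ball 0 1 \<inter> sgn -` A" "sgn -` A" lborel] assms(2) m by simp
  finally show ?thesis
    by simp
qed

lemma AE_uniform_sphere_norm: "AE y in (uniform_sphere :: 'a::euclidean_space measure). norm y = 1"
proof (rule AE_I)
  have "(sgn :: 'a \<Rightarrow> 'a) -` {y. norm y \<noteq> 1} = {0}"
    by (auto simp: norm_sgn)
  then show "emeasure (uniform_sphere :: 'a measure) {y. norm y \<noteq> 1} = 0"
    by (intro null_uniform_sphere) simp_all
qed auto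

text \<open>The unit vectors over \<open>p\<close> come from a ray, which has volume zero from dimension two on.\<close>

lemma emeasure_uniform_sphere_singleton:
  assumes "DIM('a::euclidean_space) \<ge> 2"
  shows "emeasure uniform_sphere {p::'a} = 0"
proof (rule null_uniform_sphere)
  have "sgn -` {p} \<subseteq> span {p}"
  proof
    fix w assume "w \<in> sgn -` {p}"
    then have "w = norm w *\<^sub>R p"
      by (cases "w = 0") (auto simp: sgn_div_norm)
    then show "w \<in> span {p}"
      by (metis span_base span_scale singletonI)
  qed
  then have "dim (sgn -` {p}) \<le> dim {p}"
    by (metis dim_span dim_subset)
  also have "\<dots> \<le> 1"
    using dim_le_card'[of "{p}"] by simp
  finally have "negligible (sgn -` {p})"
    using assms by (intro negligible_lowdim) simp
  then show "emeasure lborel (sgn -` {p}) = 0"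
    using measurable_sets_borel[OF sgn_borel_measurable, of "{p}"]
    by (simp add: negligible_iff_null_sets null_sets_completion_iff null_sets_def)
qed simp

lemma uniform_sphere_orthogonal_invariant:
  fixes T :: "'a::euclidean_space \<Rightarrow> 'a"
  assumes dim: "DIM('a) = 3" and T: "orthogonal_transformation T"
  shows "distr uniform_sphere borel T = uniform_sphere"
proof -
  let ?B = "ball (0::'a) 1"
  let ?U = "uniform_measure lborel ?B"
  have lin: "linear T" and nrm: "norm (T x) = norm x" for x
    using T by (simp_all add: orthogonal_transformation_linear orthogonal_transformation_norm)
  have [measurable]: "T \<in> borel_measurable borel"
    using lin by (intro borel_measurable_continuous_onI linear_continuous_on) (simp add: linear_conv_bounded_linear)
  have U: "distr ?U borel T = ?U"
  proof (rule measure_eqI)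
    fix A assume "A \<in> sets (distr ?U borel T)"
    then have A [measurable]: "A \<in> sets borel"
      by simp
    have TA: "T -` A \<in> sets borel"
      using measurable_sets_borel[of T borel A] by simp
    have "?B \<inter> T -` A = T -` (?B \<inter> A)"
      by (auto simp: nrm)
    then have "emeasure lborel (?B \<inter> T -` A) = emeasure (distr lborel borel T) (?B \<inter> A)"
      by (simp add: emeasure_distr)
    then show "emeasure (distr ?U borel T) A = emeasure ?U A"
      using TA by (simp add: emeasure_distr lborel_orthogonal_invariant[OF dim T])
  qed simp
  have "distr uniform_sphere borel T = distr ?U borel (T \<circ> sgn)"
    unfolding uniform_sphere_def by (rule distr_distr) simp_all
  also have "T \<circ> sgn = sgn \<circ> T"
    by (auto simp: sgn_div_norm nrm linear_scale[OF lin])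
  also have "distr ?U borel (sgn \<circ> T) = distr (distr ?U borel T) borel sgn"
    by (rule distr_distr[symmetric]) simp_all
  also have "\<dots> = uniform_sphere"
    by (simp add: U uniform_sphere_def)
  finally show ?thesis .
qed

lemma reflection_exchanging:
  fixes v w :: "'a::euclidean_space"
  assumes "norm v = norm w"
  obtains T where "orthogonal_transformation T" "\<And>y. T y \<bullet> v = y \<bullet> w"
proof (cases "v = w")
  case True
  then show ?thesis
    using that[of "\<lambda>x. x"] by simp
next
  case False
  define u where "u = v - w"
  define T where "T = (\<lambda>x. x - (2 * (x \<bullet> u) / (u \<bullet> u)) *\<^sub>R u)"
  have u: "u \<bullet> u \<noteq> 0"
    using False by (simp add: u_def)
  have lin: "linear T"
    by (rule linearI) (simp_all add: T_def inner_add_left algebra_simps add_divide_distrib scaleR_add_left)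
  have "T x \<bullet> T y = x \<bullet> y" for x y
    using u by (simp add: T_def inner_diff_left inner_diff_right inner_commute[of u x] inner_commute[of u y])
  then have orth: "orthogonal_transformation T"
    using lin by (simp add: orthogonal_transformation_def)
  have "u \<bullet> u = 2 * (v \<bullet> u)"
  proof -
    have "v \<bullet> v = w \<bullet> w"
      using assms by (simp add: norm_eq)
    then show ?thesis
      by (simp add: u_def inner_diff_left inner_diff_right inner_commute)
  qed
  then have "2 * (u \<bullet> v) / (u \<bullet> u) = 1"
    using u by (simp add: inner_commute)
  then have "T y \<bullet> v = y \<bullet> w" for y
  proof -
    have "T y \<bullet> v = y \<bullet> v - (y \<bullet> u) * (2 * (u \<bullet> v) / (u \<bullet> u))"
      by (simp add: T_def inner_diff_left)
    also have "\<dots> = y \<bullet> w"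
      unfolding \<open>2 * (u \<bullet> v) / (u \<bullet> u) = 1\<close> by (simp add: u_def inner_diff_right)
    finally show ?thesis .
  qed
  with orth show ?thesis
    using that by blast
qed

section \<open>Fourth moments of the uniform distribution\<close>

lemma fourth_moment_polarization:
  fixes y p q v w :: "'a::real_inner"
  shows "192 * ((y \<bullet> p) * (y \<bullet> q) * (y \<bullet> v) * (y \<bullet> w)) =
    (y \<bullet> (p + q + v + w)) ^ 4 - (y \<bullet> (p + q + v - w)) ^ 4 - (y \<bullet> (p + q - v + w)) ^ 4 + (y \<bullet> (p + q - v - w)) ^ 4
    - (y \<bullet> (p - q + v + w)) ^ 4 + (y \<bullet> (p - q + v - w)) ^ 4 + (y \<bullet> (p - q - v + w)) ^ 4 - (y \<bullet> (p - q - v - w)) ^ 4"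
  by (simp add: inner_add_right inner_diff_right) algebra

lemma norm_pow4_polarization:
  fixes p q v w :: "'a::real_inner"
  shows "192 * ((p \<bullet> q) * (v \<bullet> w) + (p \<bullet> v) * (q \<bullet> w) + (p \<bullet> w) * (q \<bullet> v)) = 3 * (
    norm (p + q + v + w) ^ 4 - norm (p + q + v - w) ^ 4 - norm (p + q - v + w) ^ 4 + norm (p + q - v - w) ^ 4
    - norm (p - q + v + w) ^ 4 + norm (p - q + v - w) ^ 4 + norm (p - q - v + w) ^ 4 - norm (p - q - v - w) ^ 4)"
proof -
  have n: "norm x ^ 4 = (x \<bullet> x)\<^sup>2" for x :: 'a
    by (simp add: dot_square_norm flip: power_mult)
  show ?thesis
    unfolding n
    by (simp add: inner_add_right inner_diff_right inner_add_left inner_diff_left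
        inner_commute[of q p] inner_commute[of v p] inner_commute[of w p]
        inner_commute[of v q] inner_commute[of w q] inner_commute[of w v]) algebra
qed

lemma integrable_uniform_sphere:
  fixes f :: "'a::euclidean_space \<Rightarrow> real"
  assumes "continuous_on UNIV f" "\<And>y. norm y = 1 \<Longrightarrow> \<bar>f y\<bar> \<le> C"
  shows "integrable uniform_sphere f"
proof -
  interpret prob_space "uniform_sphere :: 'a measure"
    by (rule prob_space_uniform_sphere)
  have "AE y in uniform_sphere. norm (f y) \<le> C"
    using AE_uniform_sphere_norm by eventually_elim (use assms(2) in simp)
  moreover have "f \<in> borel_measurable uniform_sphere"
    using borel_measurable_continuous_onI[OF assms(1)] by (simp cong: measurable_cong_sets)
  ultimately show ?thesis
    by (rule integrable_const_bound)
qed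

lemma integrable_uniform_sphere_pow4:
  "integrable uniform_sphere (\<lambda>y::'a::euclidean_space. (y \<bullet> v) ^ 4)"
proof (rule integrable_uniform_sphere)
  show "\<bar>(y \<bullet> v) ^ 4\<bar> \<le> norm v ^ 4" if "norm y = 1" for y
    unfolding power_abs using Cauchy_Schwarz_ineq2[of y v] that by (intro power_mono) auto
qed (intro continuous_intros)

text \<open>Rotation invariance and homogeneity give \<open>E (y \<bullet> v)\<^sup>4 = m \<bar>v\<bar>\<^sup>4\<close> with a constant \<open>m\<close>, and polarizing
  both sides gives the mixed moments. The constant follows from \<open>\<bar>y\<bar>\<^sup>4 = 1\<close>.\<close>

lemma uniform_sphere_fourth_moment:
  fixes p q v w :: "'a::euclidean_space"
  assumes dim: "DIM('a) = 3"
  shows "(\<integral>y. (y \<bullet> p) * (y \<bullet> q) * (y \<bullet> v) * (y \<bullet> w) \<partial>uniform_sphere) =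
    ((p \<bullet> q) * (v \<bullet> w) + (p \<bullet> v) * (q \<bullet> w) + (p \<bullet> w) * (q \<bullet> v)) / 15"
proof -
  interpret prob_space "uniform_sphere :: 'a measure"
    by (rule prob_space_uniform_sphere)
  define F where "F = (\<lambda>v::'a. \<integral>y. (y \<bullet> v) ^ 4 \<partial>uniform_sphere)"
  obtain e :: 'a where e: "e \<in> Basis"
    using nonempty_Basis by blast
  define m where "m = F e"
  have rot: "F v = F w" if nvw: "norm v = norm w" for v w
  proof -
    obtain T :: "'a \<Rightarrow> 'a" where T: "orthogonal_transformation T" "\<And>y. T y \<bullet> v = y \<bullet> w"
      using reflection_exchanging[OF nvw] by metis
    have Tm: "T \<in> measurable uniform_sphere borel"
      using orthogonal_transformation_linear[OF T(1)]
      by (auto intro!: borel_measurable_continuous_onI linear_continuous_on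
          simp: linear_conv_bounded_linear cong: measurable_cong_sets)
    have "F v = (\<integral>y. (y \<bullet> v) ^ 4 \<partial>(distr uniform_sphere borel T))"
      by (simp add: F_def uniform_sphere_orthogonal_invariant[OF dim T(1)])
    also have "\<dots> = (\<integral>y. (T y \<bullet> v) ^ 4 \<partial>uniform_sphere)"
      by (rule integral_distr[OF Tm]) simp
    also have "\<dots> = F w"
      by (simp add: F_def T(2))
    finally show ?thesis .
  qed
  have F: "F v = m * norm v ^ 4" for v
  proof -
    have "F v = F (norm v *\<^sub>R e)"
      using e by (intro rot) simp
    also have "\<dots> = m * norm v ^ 4"
      by (simp add: F_def m_def power_mult_distrib)
    finally show ?thesis .
  qed
  have G: "(\<integral>y. (y \<bullet> p) * (y \<bullet> q) * (y \<bullet> v) * (y \<bullet> w) \<partial>uniform_sphere) =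
      m / 3 * ((p \<bullet> q) * (v \<bullet> w) + (p \<bullet> v) * (q \<bullet> w) + (p \<bullet> w) * (q \<bullet> v))" for p q v w :: 'a
  proof -
    have "192 * (\<integral>y. (y \<bullet> p) * (y \<bullet> q) * (y \<bullet> v) * (y \<bullet> w) \<partial>uniform_sphere) =
      (\<integral>y. 192 * ((y \<bullet> p) * (y \<bullet> q) * (y \<bullet> v) * (y \<bullet> w)) \<partial>uniform_sphere)"
      by simp
    also have "\<dots> = F (p + q + v + w) - F (p + q + v - w) - F (p + q - v + w) + F (p + q - v - w)
        - F (p - q + v + w) + F (p - q + v - w) + F (p - q - v + w) - F (p - q - v - w)"
      unfolding fourth_moment_polarization F_def
      by (simp add: integrable_uniform_sphere_pow4 Bochner_Integration.integrable_add
          Bochner_Integration.integrable_diff)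
    also have "\<dots> = m / 3 * (192 * ((p \<bullet> q) * (v \<bullet> w) + (p \<bullet> v) * (q \<bullet> w) + (p \<bullet> w) * (q \<bullet> v)))"
      unfolding norm_pow4_polarization F by (simp add: algebra_simps)
    finally show ?thesis
      by (simp add: algebra_simps)
  qed
  \<comment> \<open>summing over an orthonormal basis turns the integrand into \<open>norm y ^ 4 = 1\<close>\<close>
  have int: "integrable uniform_sphere (\<lambda>y::'a. (y \<bullet> b) * (y \<bullet> b) * (y \<bullet> c) * (y \<bullet> c))" for b c
  proof (rule integrable_uniform_sphere)
    show "\<bar>(y \<bullet> b) * (y \<bullet> b) * (y \<bullet> c) * (y \<bullet> c)\<bar> \<le> norm b * norm b * norm c * norm c" if "norm y = 1" for y
      unfolding abs_mult using Cauchy_Schwarz_ineq2[of y b] Cauchy_Schwarz_ineq2[of y c] that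
      by (intro mult_mono) auto
  qed (intro continuous_intros)
  have "(1 :: real) = (\<integral>y. 1 \<partial>(uniform_sphere :: 'a measure))"
    using prob_space by simp
  also have "\<dots> = (\<integral>y. (\<Sum>b\<in>Basis. \<Sum>c\<in>Basis. (y \<bullet> b) * (y \<bullet> b) * (y \<bullet> c) * (y \<bullet> c)) \<partial>(uniform_sphere :: 'a measure))"
  proof (rule integral_cong_AE)
    show "AE y in (uniform_sphere :: 'a measure). 1 = (\<Sum>b\<in>Basis. \<Sum>c\<in>Basis. (y \<bullet> b) * (y \<bullet> b) * (y \<bullet> c) * (y \<bullet> c))"
      using AE_uniform_sphere_norm
    proof eventually_elim
      fix y :: 'a assume "norm y = 1"
      then have "1 = (y \<bullet> y) * (y \<bullet> y)"
        by (simp add: norm_eq_1)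
      also have "\<dots> = (\<Sum>b\<in>Basis. \<Sum>c\<in>Basis. ((y \<bullet> b) * (y \<bullet> b)) * ((y \<bullet> c) * (y \<bullet> c)))"
        unfolding euclidean_inner[of y y] by (rule sum_product)
      finally show "1 = (\<Sum>b\<in>Basis. \<Sum>c\<in>Basis. (y \<bullet> b) * (y \<bullet> b) * (y \<bullet> c) * (y \<bullet> c))"
        by (simp add: mult.assoc)
    qed
  qed (use int in \<open>auto intro!: borel_measurable_sum borel_measurable_integrable\<close>)
  also have "\<dots> = (\<Sum>b\<in>Basis. \<Sum>c\<in>Basis. \<integral>y. (y \<bullet> b) * (y \<bullet> b) * (y \<bullet> c) * (y \<bullet> c) \<partial>(uniform_sphere :: 'a measure))"
    by (simp add: int Bochner_Integration.integral_sum Bochner_Integration.integrable_sum)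
  also have "\<dots> = (\<Sum>b\<in>(Basis :: 'a set). \<Sum>c\<in>Basis. m / 3 * (1 + 2 * (if b = c then 1 else 0)))"
    unfolding G by (intro sum.cong refl) (auto simp: inner_Basis)
  also have "\<dots> = m / 3 * (\<Sum>b\<in>(Basis :: 'a set). \<Sum>c\<in>(Basis::'a set). 1 + 2 * (if b = c then 1 else 0))"
    by (simp only: sum_distrib_left)
  also have "(\<Sum>b\<in>(Basis :: 'a set). \<Sum>c\<in>(Basis::'a set). 1 + 2 * (if b = c then 1 else 0)) = (15 :: real)"
    by (simp add: sum.distrib dim flip: sum_distrib_left)
  finally have "m = 1 / 5"
    by simp
  then show ?thesis
    by (simp add: G)
qed

section \<open>Almost sure behaviour of the sample\<close>

text \<open>Hoeffding's inequality makes the probabilities of deviations of relative size \<open>\<delta>\<close> decay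
  geometrically, and the Borel-Cantelli lemma applies.\<close>

lemma (in prob_space) bounded_strong_law:
  fixes X :: "nat \<Rightarrow> 'a \<Rightarrow> real"
  assumes indep: "indep_vars (\<lambda>_. borel) X {1..}"
    and bound: "\<And>i. i \<ge> 1 \<Longrightarrow> AE \<omega> in M. \<bar>X i \<omega>\<bar> \<le> 1"
    and mean: "\<And>i. i \<ge> 1 \<Longrightarrow> expectation (X i) = \<mu>"
    and \<delta>: "\<delta> > 0"
  shows "AE \<omega> in M. \<forall>\<^sub>F N in sequentially. \<bar>(\<Sum>i\<in>{1..N}. X i \<omega>) - real N * \<mu>\<bar> < \<delta> * real N"
proof -
  define A where "A = (\<lambda>N. {\<omega> \<in> space M. \<bar>(\<Sum>i\<in>{1..N}. X i \<omega>) - real N * \<mu>\<bar> \<ge> \<delta> * real N})"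
  have X [measurable]: "random_variable borel (X i)" if "i \<ge> 1" for i
    using indep that by (auto simp: indep_vars_def)
  have A [measurable]: "A N \<in> sets M" for N
    unfolding A_def by (auto intro!: borel_measurable_le borel_measurable_sum borel_measurable_abs borel_measurable_diff X)
  have le: "prob (A N) \<le> 2 * exp (- (\<delta>\<^sup>2 / 2)) ^ N" if "N \<ge> 1" for N
  proof -
    interpret H: Hoeffding_ineq M "{1..N}" X "\<lambda>_. -1" "\<lambda>_. 1" "real N * \<mu>"
    proof unfold_locales
      show "indep_vars (\<lambda>_. borel) X {1..N}"
        using indep by (rule indep_vars_subset) auto
      show "AE x in M. X i x \<in> {-1..1}" if "i \<in> {1..N}" for i
        using bound[of i] that by (auto simp: abs_le_iff elim!: eventually_mono)
      show "real N * \<mu> \<equiv> \<Sum>i\<in>{1..N}. expectation (X i)"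
        by (rule eq_reflection) (simp add: mean)
    qed simp
    have "prob (A N) \<le> 2 * exp (- 2 * (\<delta> * real N)\<^sup>2 / (\<Sum>i\<in>{1..N}. (1 - - 1)\<^sup>2))"
      unfolding A_def using \<delta> that by (intro H.Hoeffding_ineq_abs_ge) auto
    also have "- 2 * (\<delta> * real N)\<^sup>2 / (\<Sum>i\<in>{1..N}. (1 - - 1)\<^sup>2) = real N * (- (\<delta>\<^sup>2 / 2))"
      using that by (simp add: power2_eq_square field_simps)
    also have "exp \<dots> = exp (- (\<delta>\<^sup>2 / 2)) ^ N"
      by (rule exp_of_nat_mult)
    finally show ?thesis .
  qed
  have "summable (\<lambda>N. 2 * exp (- (\<delta>\<^sup>2 / 2)) ^ N)"
    using \<delta> by (intro summable_mult summable_geometric) simp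
  then have "summable (\<lambda>N. prob (A N))"
    by (rule summable_comparison_test'[where N = 1]) (use le in simp)
  then have "AE \<omega> in M. \<forall>\<^sub>F N in sequentially. \<omega> \<in> space M - A N"
    by (intro borel_cantelli_AE1) (auto simp: less_top[symmetric])
  then show ?thesis
    by (rule eventually_mono) (auto simp: A_def elim!: eventually_mono)
qed

lemma (in prob_space) indep_vars_pairwise:
  assumes indep: "indep_vars M' X I" and "i \<in> I" "j \<in> I" "i \<noteq> j"
  shows "indep_var (M' i) (X i) (M' j) (X j)"
proof -
  have "indep_var (M' i) ((\<lambda>f. f i) \<circ> (\<lambda>\<omega>. restrict (\<lambda>k. X k \<omega>) {i}))
      (M' j) ((\<lambda>f. f j) \<circ> (\<lambda>\<omega>. restrict (\<lambda>k. X k \<omega>) {j}))"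
    using assms by (intro indep_var_compose[OF indep_var_restrict[OF indep]]) auto
  then show ?thesis
    by (simp add: comp_def)
qed

text \<open>Repeated points would be counted once in \<open>X\<^sub>N\<close> but several times in sample averages. By Fubini's
  theorem they almost surely do not occur.\<close>

lemma (in prob_space) AE_indep_distinct:
  fixes X Y :: "'a \<Rightarrow> 'b::euclidean_space"
  assumes indep: "indep_var borel X borel Y"
    and atomless: "\<And>p. emeasure (distr M borel Y) {p} = 0"
  shows "AE \<omega> in M. X \<omega> \<noteq> Y \<omega>"
proof -
  have [measurable]: "random_variable borel X" "random_variable borel Y"
    using indep by (auto dest: indep_var_rv1 indep_var_rv2)
  interpret X: prob_space "distr M borel X" by (rule prob_space_distr) simp
  interpret Y: prob_space "distr M borel Y" by (rule prob_space_distr) simp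
  interpret pair_sigma_finite "distr M borel X" "distr M borel Y" ..
  have "AE z in distr M borel X \<Otimes>\<^sub>M distr M borel Y. fst z \<noteq> snd z"
  proof (rule AE_pair_measure)
    show "{x \<in> space (distr M borel X \<Otimes>\<^sub>M distr M borel Y). fst x \<noteq> snd x} \<in>
        sets (distr M borel X \<Otimes>\<^sub>M distr M borel Y)"
      by measurable
    have "AE y in distr M borel Y. p \<noteq> y" for p
      by (rule AE_I[where N = "{p}"]) (use atomless in auto)
    then show "AE p in distr M borel X. AE y in distr M borel Y. fst (p, y) \<noteq> snd (p, y)"
      by simp
  qed
  also have "distr M borel X \<Otimes>\<^sub>M distr M borel Y = distr M (borel \<Otimes>\<^sub>M borel) (\<lambda>\<omega>. (X \<omega>, Y \<omega>))"
    using indep by (simp add: indep_var_distribution_eq)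
  finally show ?thesis
    by (subst (asm) AE_distr_iff) (auto simp: pred_def[symmetric])
qed

text \<open>Only finitely many moments, those of basis vectors, are controlled directly. Expanding one argument
  after the other in the basis extends the control to all directions at once, at the price of a
  factor \<open>DIM('a)\<close> for each argument.\<close>

lemma quadrilinear_bound:
  fixes X :: "'a::euclidean_space set" and \<delta> :: real
  assumes "finite X"
    and \<delta>: "\<And>b c d e. b \<in> Basis \<Longrightarrow> c \<in> Basis \<Longrightarrow> d \<in> Basis \<Longrightarrow> e \<in> Basis \<Longrightarrow>
      \<bar>(\<Sum>y\<in>X. (y \<bullet> b) * (y \<bullet> c) * (y \<bullet> d) * (y \<bullet> e)) -
        k * ((b \<bullet> c) * (d \<bullet> e) + (b \<bullet> d) * (c \<bullet> e) + (b \<bullet> e) * (c \<bullet> d))\<bar> \<le> \<delta>"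
  shows "\<bar>(\<Sum>y\<in>X. (y \<bullet> p) * (y \<bullet> q) * (y \<bullet> v) * (y \<bullet> w)) -
      k * ((p \<bullet> q) * (v \<bullet> w) + (p \<bullet> v) * (q \<bullet> w) + (p \<bullet> w) * (q \<bullet> v))\<bar>
    \<le> real DIM('a) ^ 4 * \<delta> * (norm p * norm q * norm v * norm w)"
proof -
  define L where "L = (\<lambda>p q v w. (\<Sum>y\<in>X. (y \<bullet> p) * (y \<bullet> q) * (y \<bullet> v) * (y \<bullet> w)) -
      k * ((p \<bullet> q) * (v \<bullet> w) + (p \<bullet> v) * (q \<bullet> w) + (p \<bullet> w) * (q \<bullet> v)))"
  have step: "\<bar>g v\<bar> \<le> real DIM('a) * C * norm v"
    if g: "linear g" and C: "\<And>b. b \<in> Basis \<Longrightarrow> \<bar>g b\<bar> \<le> C" for g :: "'a \<Rightarrow> real" and C v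
  proof -
    have "g v = (\<Sum>b\<in>Basis. (v \<bullet> b) * g b)"
      by (subst euclidean_representation[of v, symmetric])
        (simp only: linear_sum[OF g] linear_scale[OF g] real_scaleR_def)
    then have "\<bar>g v\<bar> \<le> (\<Sum>b\<in>Basis. \<bar>(v \<bullet> b) * g b\<bar>)"
      by simp
    also have "\<dots> \<le> (\<Sum>b\<in>(Basis::'a set). norm v * C)"
      unfolding abs_mult by (intro sum_mono mult_mono C Basis_le_norm) auto
    finally show ?thesis
      by (simp add: mult_ac)
  qed
  have lin: "linear (\<lambda>p. L p q v w)" "linear (\<lambda>q. L p q v w)" "linear (\<lambda>v. L p q v w)" "linear (L p q v)"
    for p q v w
    by (rule linearI; simp add: L_def inner_add_left inner_add_right algebra_simps sum.distrib sum_distrib_left)+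
  have 1: "\<bar>L p c d e\<bar> \<le> real DIM('a) * \<delta> * norm p" if "c \<in> Basis" "d \<in> Basis" "e \<in> Basis" for p c d e
    using \<delta> that by (intro step[OF lin(1)]) (simp add: L_def)
  have 2: "\<bar>L p q d e\<bar> \<le> real DIM('a) * (real DIM('a) * \<delta> * norm p) * norm q" if "d \<in> Basis" "e \<in> Basis" for p q d e
    using that by (intro step[OF lin(2)] 1)
  have 3: "\<bar>L p q v e\<bar> \<le> real DIM('a) * (real DIM('a) * (real DIM('a) * \<delta> * norm p) * norm q) * norm v" if "e \<in> Basis" for p q v e
    using that by (intro step[OF lin(3)] 2)
  have "\<bar>L p q v w\<bar> \<le> real DIM('a) * (real DIM('a) * (real DIM('a) * (real DIM('a) * \<delta> * norm p) * norm q) * norm v) * norm w"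
    by (intro step[OF lin(4)] 3)
  then show ?thesis
    by (simp add: L_def power4_eq_xxxx mult_ac)
qed

text \<open>The second moments are contained in the fourth ones, because \<open>\<Sum>\<^sub>b (y \<bullet> b)\<^sup>2 = \<bar>y\<bar>\<^sup>2 = 1\<close> on the sphere.
  This sum of three terms, each with an error factor \<open>3 ^ 4 = 81\<close>, explains \<open>243\<close>.\<close>

lemma nearly_isotropic_if_fourth_moments:
  fixes X :: "'a::euclidean_space set"
  assumes dim: "DIM('a) = 3" and X: "finite X" "X \<noteq> {}" "X \<subseteq> sphere 0 1"
    and "\<epsilon> > 0"
    and \<delta>: "\<And>b c d e. b \<in> Basis \<Longrightarrow> c \<in> Basis \<Longrightarrow> d \<in> Basis \<Longrightarrow> e \<in> Basis \<Longrightarrow>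
      \<bar>(\<Sum>y\<in>X. (y \<bullet> b) * (y \<bullet> c) * (y \<bullet> d) * (y \<bullet> e)) -
        card X * (((b \<bullet> c) * (d \<bullet> e) + (b \<bullet> d) * (c \<bullet> e) + (b \<bullet> e) * (c \<bullet> d)) / 15)\<bar> \<le> \<epsilon> / 243 * card X"
  shows "nearly_isotropic \<epsilon> X"
proof -
  define n where "n = real (card X)"
  have n: "n \<ge> 0"
    by (simp add: n_def)
  have quad: "\<bar>(\<Sum>y\<in>X. (y \<bullet> p) * (y \<bullet> q) * (y \<bullet> v) * (y \<bullet> w)) -
      (n / 15) * ((p \<bullet> q) * (v \<bullet> w) + (p \<bullet> v) * (q \<bullet> w) + (p \<bullet> w) * (q \<bullet> v))\<bar>
    \<le> real DIM('a) ^ 4 * (\<epsilon> / 243 * n) * (norm p * norm q * norm v * norm w)" for p q v w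
    by (rule quadrilinear_bound[OF X(1)]) (use \<delta> in \<open>simp add: n_def\<close>)
  have two: "\<bar>(\<Sum>y\<in>X. (y \<bullet> v) * (y \<bullet> w)) - n * ((v \<bullet> w) / 3)\<bar> \<le> \<epsilon> * n * (norm v * norm w)" for v w
  proof -
    have "(\<Sum>b\<in>Basis. \<Sum>y\<in>X. (y \<bullet> b) * (y \<bullet> b) * (y \<bullet> v) * (y \<bullet> w)) = (\<Sum>y\<in>X. (y \<bullet> y) * ((y \<bullet> v) * (y \<bullet> w)))"
      by (subst sum.swap) (simp only: euclidean_inner[of "y::'a" y for y] sum_distrib_right mult.assoc)
    also have "\<dots> = (\<Sum>y\<in>X. (y \<bullet> v) * (y \<bullet> w))"
      using X(3) by (intro sum.cong) (auto simp: norm_eq_1)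
    finally have 1: "(\<Sum>b\<in>Basis. \<Sum>y\<in>X. (y \<bullet> b) * (y \<bullet> b) * (y \<bullet> v) * (y \<bullet> w)) = (\<Sum>y\<in>X. (y \<bullet> v) * (y \<bullet> w))" .
    have "(\<Sum>b\<in>Basis. (n / 15) * ((b \<bullet> b) * (v \<bullet> w) + (b \<bullet> v) * (b \<bullet> w) + (b \<bullet> w) * (b \<bullet> v))) =
        (\<Sum>b\<in>(Basis :: 'a set). (n / 15) * ((v \<bullet> w) + 2 * ((v \<bullet> b) * (w \<bullet> b))))"
      by (intro sum.cong refl) (simp add: inner_Basis inner_commute)
    also have "\<dots> = (n / 15) * (3 * (v \<bullet> w) + 2 * (v \<bullet> w))"
      by (simp only: sum_distrib_left[symmetric] sum.distrib euclidean_inner[of v w, symmetric])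
        (simp add: dim)
    finally have 2: "(\<Sum>b\<in>Basis. (n / 15) * ((b \<bullet> b) * (v \<bullet> w) + (b \<bullet> v) * (b \<bullet> w) + (b \<bullet> w) * (b \<bullet> v))) =
        n * ((v \<bullet> w) / 3)"
      by simp
    have "\<bar>\<Sum>b\<in>Basis. (\<Sum>y\<in>X. (y \<bullet> b) * (y \<bullet> b) * (y \<bullet> v) * (y \<bullet> w)) -
        (n / 15) * ((b \<bullet> b) * (v \<bullet> w) + (b \<bullet> v) * (b \<bullet> w) + (b \<bullet> w) * (b \<bullet> v))\<bar>
      \<le> (\<Sum>b\<in>(Basis :: 'a set). real DIM('a) ^ 4 * (\<epsilon> / 243 * n) * (norm b * norm b * norm v * norm w))"
      by (rule order_trans[OF sum_abs]) (intro sum_mono quad)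
    also have "\<dots> = \<epsilon> * n * (norm v * norm w)"
      by (simp add: dim)
    finally show ?thesis
      by (simp only: sum_subtractf 1 2)
  qed
  have four: "\<bar>(\<Sum>y\<in>X. (y \<bullet> v) ^ 3 * (y \<bullet> w)) - n * ((v \<bullet> w) / 5)\<bar> \<le> \<epsilon> * n * norm w"
    if "norm v = 1" for v w
  proof -
    have v: "v \<bullet> v = 1"
      using that by (simp add: norm_eq_1)
    have "\<bar>(\<Sum>y\<in>X. (y \<bullet> v) ^ 3 * (y \<bullet> w)) - n * ((v \<bullet> w) / 5)\<bar> \<le> (\<epsilon> / 3) * n * norm w"
      using quad[of v v v w] that by (simp add: dim v power3_eq_cube)
    also have "\<dots> \<le> \<epsilon> * n * norm w"
      using \<open>\<epsilon> > 0\<close> n by (intro mult_right_mono) auto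
    finally show ?thesis .
  qed
  show ?thesis
    unfolding nearly_isotropic_def using X two four by (simp add: n_def)
qed

theorem theorem1:
  fixes M :: "'w measure"
    and x :: "nat \<Rightarrow> 'w \<Rightarrow> 'a::euclidean_space"
  assumes dimV: "DIM('a) = 3"
    and "prob_space M"
    and on_sphere: "\<And>i \<omega>. i \<ge> 1 \<Longrightarrow> \<omega> \<in> space M \<Longrightarrow> x i \<omega> \<in> sphere 0 1"
    and indep: "prob_space.indep_vars M (\<lambda>_. borel) x {1..}"
    and uniform: "\<And>i. i \<ge> 1 \<Longrightarrow> distr M borel (x i) = uniform_sphere"
  shows "AE \<omega> in M. \<forall>\<^sub>F N in sequentially.
    dim (eigenspaces_above ((\<lambda>i. x i \<omega>) ` {1..N}) (1 / 3)) = 3"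
proof -
  interpret prob_space M by fact
  have rv [measurable]: "random_variable borel (x i)" if "i \<ge> 1" for i
    using indep that by (auto simp: indep_vars_def)
  define \<delta> :: real where "\<delta> = 1 / 1000 / 243"
  have distinct: "AE \<omega> in M. \<forall>i j. 1 \<le> i \<and> 1 \<le> j \<and> i \<noteq> j \<longrightarrow> x i \<omega> \<noteq> x j \<omega>"
  proof -
    have "AE \<omega> in M. x i \<omega> \<noteq> x j \<omega>" if "1 \<le> i \<and> 1 \<le> j \<and> i \<noteq> j" for i j
    proof (rule AE_indep_distinct)
      show "indep_var borel (x i) borel (x j)"
        using that by (intro indep_vars_pairwise[OF indep]) auto
      show "emeasure (distr M borel (x j)) {p} = 0" for p
        using that dimV by (simp add: uniform emeasure_uniform_sphere_singleton)
    qed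
    then show ?thesis
      by (simp add: AE_all_countable)
  qed
  define E where "E = (\<lambda>b c d e::'a. ((b \<bullet> c) * (d \<bullet> e) + (b \<bullet> d) * (c \<bullet> e) + (b \<bullet> e) * (c \<bullet> d)) / 15)"
  have moment: "AE \<omega> in M. \<forall>\<^sub>F N in sequentially.
      \<bar>(\<Sum>i\<in>{1..N}. (x i \<omega> \<bullet> b) * (x i \<omega> \<bullet> c) * (x i \<omega> \<bullet> d) * (x i \<omega> \<bullet> e)) - real N * E b c d e\<bar> < \<delta> * real N"
    if B: "b \<in> Basis" "c \<in> Basis" "d \<in> Basis" "e \<in> Basis" for b c d e
  proof (rule bounded_strong_law)
    define f where "f = (\<lambda>y::'a. (y \<bullet> b) * (y \<bullet> c) * (y \<bullet> d) * (y \<bullet> e))"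
    have f [measurable]: "f \<in> borel_measurable borel"
      unfolding f_def by measurable
    show "indep_vars (\<lambda>_. borel) (\<lambda>i \<omega>. (x i \<omega> \<bullet> b) * (x i \<omega> \<bullet> c) * (x i \<omega> \<bullet> d) * (x i \<omega> \<bullet> e)) {1..}"
      using indep_vars_compose2[OF indep, of "\<lambda>_. f" "\<lambda>_. borel"] by (simp add: f_def)
    show "AE \<omega> in M. \<bar>(x i \<omega> \<bullet> b) * (x i \<omega> \<bullet> c) * (x i \<omega> \<bullet> d) * (x i \<omega> \<bullet> e)\<bar> \<le> 1" if "i \<ge> 1" for i
    proof (rule AE_I2)
      fix \<omega> assume "\<omega> \<in> space M"
      then have n: "norm (x i \<omega>) = 1"
        using on_sphere[OF that] by simp
      have "\<bar>x i \<omega> \<bullet> a\<bar> \<le> 1" if "a \<in> Basis" for a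
        using Basis_le_norm[OF that, of "x i \<omega>"] n by simp
      with B show "\<bar>(x i \<omega> \<bullet> b) * (x i \<omega> \<bullet> c) * (x i \<omega> \<bullet> d) * (x i \<omega> \<bullet> e)\<bar> \<le> 1"
        unfolding abs_mult by (intro mult_le_one mult_nonneg_nonneg abs_ge_zero) auto
    qed
    show "expectation (\<lambda>\<omega>. (x i \<omega> \<bullet> b) * (x i \<omega> \<bullet> c) * (x i \<omega> \<bullet> d) * (x i \<omega> \<bullet> e)) = E b c d e" if "i \<ge> 1" for i
    proof -
      have "expectation (\<lambda>\<omega>. f (x i \<omega>)) = (\<integral>y. f y \<partial>(distr M borel (x i)))"
        by (rule integral_distr[symmetric]) (use rv[OF that] in auto)
      then show ?thesis
        by (simp add: uniform[OF that] f_def uniform_sphere_fourth_moment[OF dimV] E_def)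
    qed
    show "\<delta> > 0"
      by (simp add: \<delta>_def)
  qed
  have "AE \<omega> in M. \<forall>b\<in>Basis. \<forall>c\<in>Basis. \<forall>d\<in>Basis. \<forall>e\<in>Basis. \<forall>\<^sub>F N in sequentially.
      \<bar>(\<Sum>i\<in>{1..N}. (x i \<omega> \<bullet> b) * (x i \<omega> \<bullet> c) * (x i \<omega> \<bullet> d) * (x i \<omega> \<bullet> e)) - real N * E b c d e\<bar> < \<delta> * real N"
    using moment by (intro AE_finite_allI finite_Basis)
  with distinct AE_space show ?thesis
  proof eventually_elim
    case (elim \<omega>)
    have "\<forall>\<^sub>F N in sequentially. \<forall>b\<in>Basis. \<forall>c\<in>Basis. \<forall>d\<in>Basis. \<forall>e\<in>Basis.
      \<bar>(\<Sum>i\<in>{1..N}. (x i \<omega> \<bullet> b) * (x i \<omega> \<bullet> c) * (x i \<omega> \<bullet> d) * (x i \<omega> \<bullet> e)) - real N * E b c d e\<bar> < \<delta> * real N"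
      using elim(3) by (simp add: eventually_ball_finite_distrib)
    with eventually_ge_at_top[of 1] show ?case
    proof eventually_elim
      case (elim N)
      let ?X = "(\<lambda>i. x i \<omega>) ` {1..N}"
      have inj: "inj_on (\<lambda>i. x i \<omega>) {1..N}"
        using \<open>\<forall>i j. 1 \<le> i \<and> 1 \<le> j \<and> i \<noteq> j \<longrightarrow> x i \<omega> \<noteq> x j \<omega>\<close> unfolding inj_on_def
        by (metis atLeastAtMost_iff)
      then have card: "card ?X = N"
        by (simp add: card_image)
      have "nearly_isotropic (1 / 1000) ?X"
      proof (rule nearly_isotropic_if_fourth_moments[OF dimV])
        show "?X \<subseteq> sphere 0 1"
          using on_sphere \<open>\<omega> \<in> space M\<close> by auto
        show "\<bar>(\<Sum>y\<in>?X. (y \<bullet> b) * (y \<bullet> c) * (y \<bullet> d) * (y \<bullet> e)) -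
            card ?X * (((b \<bullet> c) * (d \<bullet> e) + (b \<bullet> d) * (c \<bullet> e) + (b \<bullet> e) * (c \<bullet> d)) / 15)\<bar> \<le> 1 / 1000 / 243 * card ?X"
          if "b \<in> Basis" "c \<in> Basis" "d \<in> Basis" "e \<in> Basis" for b c d e
          using elim(2) that unfolding card sum.reindex[OF inj] E_def \<delta>_def by (force simp: less_imp_le)
      qed (use elim(1) in auto)
      then show ?case
        using dim_eigenspaces_above_third dimV by metis
    qed
  qed
qed

end
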